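(* Let $p \in [1,\infty)$ and $T>0$. Let $W_n$ ($n\in\mathbb{N}$) be a sequence of graphs (identified with their step-graphons on $(0,1)^2$) and let $W$ be a graphon, all satisfying the standing graphon assumption, with $W_n, W \in L^1((0,1)^2)$ and $\|W_n - W\|_\square \to 0$ as $n\to\infty$. Let $u_n \in C^1([0,T];L^p((0,1)))$ be the solution of the graph diffusion equation $\partial_t u_n = \mathcal{L}^{W_n}u_n$ with initial condition $u_n(\cdot,0)\in L^p((0,1))$, and let $u \in C^1([0,T];L^\infty((0,1)))$ be the solution of the graphon diffusion equation $\partial_t u = \mathcal{L}^{W}u$ with initial condition $u(\cdot,0)\in L^\infty((0,1))$. Then for all $n$ and all $t\in[0,T]$, $$\|u(\cdot,t)-u_n(\cdot,t)\|_p \le \|u(\cdot,0)-u_n(\cdot,0)\|_p + 4t\,\|u(\cdot,0)\|_\infty\,\|W_n-W\|_\square^{1/p}.$$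
   Context: Standing graphon assumption (on every graph/graphon $W$): $W\in L^1((0,1)^2)$, $W(x,y)=W(y,x)\ge 0$ for all $(x,y)\in(0,1)^2$, and the degree $d_W(x):=\int_0^1 W(x,y)\,dy\le 1$ for a.e. $x\in(0,1)$. Graphs as graphons: a graph on $n$ nodes is weighted, undirected and simple, with symmetric adjacency matrix $(A^{(n)}_{ij})_{i,j=1}^n$; it is identified with the step-graphon $W_n(x,y)=A^{(n)}_{ij}$ for $(x,y)\in I_i\times I_j$, where $I_k=((k-1)/n,k/n]$ for $k\le n-1$ and $I_n=((n-1)/n,1)$. Diffusion operator: $\mathcal{L}^W u(x)=\int_0^1 W(x,y)\,(u(y)-u(x))\,dy$. It is a bounded linear operator on $L^p((0,1))$ for every $p\in[1,\infty]$ under the standing assumption. Solutions are classical: the equation holds as an identity in the given $L^p$ space for $t\in[0,T]$. Cut norm: $\|V\|_\square=\sup_{\phi,\psi}\int_0^1\int_0^1 V(x,y)\phi(x)\psi(y)\,dx\,dy$, the supremum over measurable $\phi,\psi:(0,1)\to[-1,1]$. *)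

theory Defs
  imports "HOL-Probability.Essential_Supremum"
begin

abbreviation unit_ivl :: "real set" where
  "unit_ivl \<equiv> {0<..<1}"

abbreviation unit_leb :: "real measure" where
  "unit_leb \<equiv> lebesgue_on unit_ivl"

text \<open>Elements of the spaces $L^p((0,1))$, $p \in [1,\infty]$, are represented by functions
  \<open>real \<Rightarrow> real\<close>, of which only the restriction to $(0,1)$ matters; equality of elements is
  equality almost everywhere.\<close>

definition Lp_space :: "ereal \<Rightarrow> (real \<Rightarrow> real) set" where
  "Lp_space p = {f \<in> borel_measurable unit_leb.
     if p = \<infinity> then esssup unit_leb (\<lambda>x. ereal \<bar>f x\<bar>) < \<infinity>
     else integrable unit_leb (\<lambda>x. \<bar>f x\<bar> powr real_of_ereal p)}"

definition Lp_norm :: "ereal \<Rightarrow> (real \<Rightarrow> real) \<Rightarrow> real" where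
  "Lp_norm p f =
     (if p = \<infinity> then real_of_ereal (esssup unit_leb (\<lambda>x. ereal \<bar>f x\<bar>))
      else (\<integral>x. \<bar>f x\<bar> powr real_of_ereal p \<partial>unit_leb) powr (1 / real_of_ereal p))"

definition degree :: "(real \<Rightarrow> real \<Rightarrow> real) \<Rightarrow> real \<Rightarrow> real" where
  "degree W x = (\<integral>y. W x y \<partial>unit_leb)"

definition graphon :: "(real \<Rightarrow> real \<Rightarrow> real) \<Rightarrow> bool" where
  "graphon W \<longleftrightarrow>
     integrable (lebesgue_on (unit_ivl \<times> unit_ivl)) (\<lambda>(x, y). W x y) \<and>
     (\<forall>x\<in>unit_ivl. \<forall>y\<in>unit_ivl. W x y = W y x \<and> 0 \<le> W x y) \<and>
     (AE x in unit_leb. degree W x \<le> 1)"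

text \<open>Nodes are \<open>1, \<dots>, n\<close>.  Nonnegativity of the weights is not part of this predicate; it is
  imposed by \<^const>\<open>graphon\<close> on the associated step graphon.\<close>

definition weighted_simple_graph :: "nat \<Rightarrow> (nat \<Rightarrow> nat \<Rightarrow> real) \<Rightarrow> bool" where
  "weighted_simple_graph n A \<longleftrightarrow>
     (\<forall>i\<in>{1..n}. \<forall>j\<in>{1..n}. A i j = A j i) \<and> (\<forall>i\<in>{1..n}. A i i = 0)"

definition node_ivl :: "nat \<Rightarrow> nat \<Rightarrow> real set" where
  "node_ivl n k =
     (if k < n then {(real k - 1) / real n <.. real k / real n}
      else {(real n - 1) / real n <..< 1})"

text \<open>The intervals \<open>node_ivl n 1, \<dots>, node_ivl n n\<close> partition $(0,1)$, so on the unit square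
  exactly one summand is selected.\<close>

definition step_graphon :: "nat \<Rightarrow> (nat \<Rightarrow> nat \<Rightarrow> real) \<Rightarrow> real \<Rightarrow> real \<Rightarrow> real" where
  "step_graphon n A x y =
     (\<Sum>i=1..n. \<Sum>j=1..n. A i j * indicator (node_ivl n i) x * indicator (node_ivl n j) y)"

definition diffusion_op :: "(real \<Rightarrow> real \<Rightarrow> real) \<Rightarrow> (real \<Rightarrow> real) \<Rightarrow> real \<Rightarrow> real" where
  "diffusion_op W f x = (\<integral>y. W x y * (f y - f x) \<partial>unit_leb)"

definition cut_norm :: "(real \<Rightarrow> real \<Rightarrow> real) \<Rightarrow> real" where
  "cut_norm V = Sup {\<integral>y. (\<integral>x. V x y * \<phi> x * \<psi> y \<partial>unit_leb) \<partial>unit_leb | \<phi> \<psi>.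
     \<phi> \<in> borel_measurable unit_leb \<and> \<psi> \<in> borel_measurable unit_leb \<and>
     (\<forall>x\<in>unit_ivl. \<phi> x \<in> {-1..1}) \<and> (\<forall>y\<in>unit_ivl. \<psi> y \<in> {-1..1})}"

text \<open>\<open>C1_Lp p T u u'\<close>: the curve \<open>u\<close> belongs to $C^1([0,T];L^p((0,1)))$ and has derivative \<open>u'\<close>
  (one-sided at the end points).  Differentiability of \<open>u\<close> and continuity of \<open>u'\<close> are both with
  respect to the $L^p$ norm.\<close>

definition C1_Lp ::
    "ereal \<Rightarrow> real \<Rightarrow> (real \<Rightarrow> real \<Rightarrow> real) \<Rightarrow> (real \<Rightarrow> real \<Rightarrow> real) \<Rightarrow> bool" where
  "C1_Lp p T u u' \<longleftrightarrow>
     (\<forall>t\<in>{0..T}.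
        u t \<in> Lp_space p \<and> u' t \<in> Lp_space p \<and>
        ((\<lambda>s. Lp_norm p (\<lambda>x. (u s x - u t x) / (s - t) - u' t x)) \<longlongrightarrow> 0) (at t within {0..T}) \<and>
        ((\<lambda>s. Lp_norm p (\<lambda>x. u' s x - u' t x)) \<longlongrightarrow> 0) (at t within {0..T}))"

definition diffusion_solution ::
    "ereal \<Rightarrow> real \<Rightarrow> (real \<Rightarrow> real \<Rightarrow> real) \<Rightarrow> (real \<Rightarrow> real \<Rightarrow> real) \<Rightarrow> bool" where
  "diffusion_solution p T W u \<longleftrightarrow>
     (\<exists>u'. C1_Lp p T u u' \<and>
        (\<forall>t\<in>{0..T}. AE x in unit_leb. u' t x = diffusion_op W (u t) x))"

end

theory Submission
  imports Defs "HOL-Probability.Probability_Measure"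
begin

text \<open>For a graphon of degree at most one and $0 \le h \le 1$, the forward Euler step
  $f \mapsto f + h \mathcal{L}^W f$ averages with symmetric weights of total mass one.  By Jensen's
  inequality it is a contraction of $L^p$, and it preserves bounds in $L^\infty$.  Since
  $v = u - u_n$ satisfies $v' = \mathcal{L}^{W_n} v + r$ with
  $r = (\mathcal{L}^W - \mathcal{L}^{W_n}) u$, one Euler step increases $\|v\|_p$ by at most
  $h \|r\|_p + o(h)$, so no derivative of the norm is needed.  With $M = \|u(0)\|_\infty$ the
  maximum principle gives $|r| \le 4M$, while testing $r$ against its sign gives
  $\|r\|_1 \le 2 M \|W_n - W\|_\square$; interpolation yields
  $\|r\|_p \le 4 M \|W_n - W\|_\square^{1/p}$.\<close>

section \<open>The spaces $L^p((0,1))$\<close>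

text \<open>A graphon is only Lebesgue measurable on the square and may fail to be measurable for
  \<open>unit_leb \<Otimes>\<^sub>M unit_leb\<close>, whereas a step graphon is bounded and product
  measurable. This asymmetry dictates the splitting. The L^p contraction integrates over both
  variables and swaps them, so it is applied to \<open>W_n\<close> only. The general W meets only
  the bounded function u, where estimates on almost every single section suffice; hence r carries u
  and not u_n, which is merely in L^p. The 4 is a pointwise constant: each of the two operators is
  bounded by 2M on functions bounded by M, one M coming from the integral of W f and one from the
  degree times f. The cut norm alone would give a factor 2, absorbed when the two bounds are
  combined. Several steps divide by M, which fails for u(0) = 0; the estimate is therefore proved
  for every M above the initial sup norm, and M is lowered to that norm at the very end.\<close>

lemma space_unit_leb: "space unit_leb = unit_ivl"
  by simp

lemma prob_space_unit_leb: "prob_space unit_leb"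
proof
  show "emeasure unit_leb (space unit_leb) = 1"
    by (simp add: emeasure_restrict_space)
qed

interpretation unit_leb: prob_space unit_leb
  by (rule prob_space_unit_leb)

interpretation unit_leb_pair: pair_prob_space unit_leb unit_leb ..

text \<open>Supporting line of a convex function. Taken at a mean m and averaged, its linear term
  cancels, which is Jensen's inequality; this form is used both for Minkowski and for the Euler
  step. The boundary is separate because the derivative is taken at positive points; for m = 0 the
  left side vanishes by the convention that \<open>0 powr x\<close> is 0.\<close>

lemma powr_above_tangent:
  fixes p a m :: real
  assumes "1 \<le> p" "0 \<le> a" "0 \<le> m"
  shows "m powr p + p * m powr (p - 1) * (a - m) \<le> a powr p"
proof (cases "m = 0 \<or> a = 0")
  case True
  show ?thesis
  proof (cases "m = 0")
    case False
    then have m: "m > 0" "a = 0" using True assms by auto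
    then have "m powr (p - 1) * m = m powr p"
      by (simp add: powr_diff)
    then have "m powr p + p * m powr (p - 1) * (a - m) = (1 - p) * m powr p"
      using m by (simp add: algebra_simps)
    also have "\<dots> \<le> 0" using assms by (simp add: mult_nonpos_nonneg)
    finally show ?thesis by (meson order_trans powr_ge_zero)
  qed auto
next
  case False
  then have pos: "m > 0" "a > 0" using assms by auto
  have "p * m powr (p - 1) * (a - m) \<le> a powr p - m powr p"
  proof (rule convex_on_imp_above_tangent[where A = "{0<..}"])
    show "convex_on {0<..} (\<lambda>x. x powr p)" using assms powr_convex by blast
    show "((\<lambda>x. x powr p) has_real_derivative p * m powr (p - 1)) (at m within {0<..})"
      using pos by (auto intro!: derivative_eq_intros)
  qed (use pos in \<open>auto simp: interior_open\<close>)
  then show ?thesis by simp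
qed

lemma powr_convex_combination:
  fixes p s t x y :: real
  assumes "1 \<le> p" "0 \<le> s" "0 \<le> t" "s + t = 1" "0 \<le> x" "0 \<le> y"
  shows "(s * x + t * y) powr p \<le> s * x powr p + t * y powr p"
proof -
  define m where "m = s * x + t * y"
  define c where "c = p * m powr (p - 1)"
  have m: "0 \<le> m" unfolding m_def using assms by simp
  \<comment> \<open>Both tangent inequalities are taken at the mean m, so the terms with slope c
    cancel in the weighted sum.\<close>
  have "s * (m powr p + c * (x - m)) \<le> s * x powr p" "t * (m powr p + c * (y - m)) \<le> t * y powr p"
    using powr_above_tangent[OF assms(1) assms(5) m] powr_above_tangent[OF assms(1) assms(6) m] assms
    by (auto simp: c_def intro!: mult_left_mono)
  moreover have "s * (m powr p + c * (x - m)) + t * (m powr p + c * (y - m))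
      = (s + t) * m powr p + c * (m - (s + t) * m)"
    by (simp add: m_def algebra_simps)
  ultimately show ?thesis using assms by (simp add: m_def)
qed

section \<open>Norms, Minkowski's inequality and inclusions for L^p and L^\<infinity>\<close>

lemma Lp_space_ereal:
  "f \<in> Lp_space (ereal p) \<longleftrightarrow>
    f \<in> borel_measurable unit_leb \<and> integrable unit_leb (\<lambda>x. \<bar>f x\<bar> powr p)"
  by (simp add: Lp_space_def)

lemma Lp_norm_ereal: "Lp_norm (ereal p) f = (\<integral>x. \<bar>f x\<bar> powr p \<partial>unit_leb) powr (1 / p)"
  by (simp add: Lp_norm_def)

lemma Lp_space_measurable: "f \<in> Lp_space q \<Longrightarrow> f \<in> borel_measurable unit_leb"
  by (simp add: Lp_space_def)

lemma Lp_norm_le_iff: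
  assumes "1 \<le> p" "0 \<le> c"
  shows "Lp_norm (ereal p) f \<le> c \<longleftrightarrow> (\<integral>x. \<bar>f x\<bar> powr p \<partial>unit_leb) \<le> c powr p"
proof -
  let ?I = "\<integral>x. \<bar>f x\<bar> powr p \<partial>unit_leb"
  have I: "0 \<le> ?I" by (intro integral_nonneg_AE) auto
  have "?I powr (1 / p) \<le> c \<longleftrightarrow> (?I powr (1 / p)) powr p \<le> c powr p"
    using assms powr_mono2[of p "?I powr (1 / p)" c] powr_less_mono2[of p c "?I powr (1 / p)"]
    by (auto simp: not_less[symmetric])
  also have "(?I powr (1 / p)) powr p = ?I"
    using assms I by (simp add: powr_powr)
  finally show ?thesis by (simp add: Lp_norm_ereal)
qed

lemma Lp_inf_bounded_iff:
  "f \<in> Lp_space \<infinity> \<longleftrightarrow>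
    f \<in> borel_measurable unit_leb \<and> (\<exists>c. AE x in unit_leb. \<bar>f x\<bar> \<le> c)"
proof
  assume f: "f \<in> Lp_space \<infinity>"
  let ?E = "esssup unit_leb (\<lambda>x. ereal \<bar>f x\<bar>)"
  have "?E < \<infinity>" using f by (simp add: Lp_space_def)
  then obtain c where c: "?E \<le> ereal c"
    by (cases ?E) auto
  have "AE x in unit_leb. ereal \<bar>f x\<bar> \<le> ?E" by (rule esssup_AE)
  then have "AE x in unit_leb. \<bar>f x\<bar> \<le> c"
    by eventually_elim (use c in \<open>metis ereal_less_eq(3) order_trans\<close>)
  with f show "f \<in> borel_measurable unit_leb \<and> (\<exists>c. AE x in unit_leb. \<bar>f x\<bar> \<le> c)"
    by (auto simp: Lp_space_def)
next
  assume "f \<in> borel_measurable unit_leb \<and> (\<exists>c. AE x in unit_leb. \<bar>f x\<bar> \<le> c)"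
  then obtain c where [measurable]: "f \<in> borel_measurable unit_leb"
    and c: "AE x in unit_leb. \<bar>f x\<bar> \<le> c" by auto
  have "esssup unit_leb (\<lambda>x. ereal \<bar>f x\<bar>) \<le> ereal c"
    using c by (intro esssup_I) auto
  then show "f \<in> Lp_space \<infinity>"
    by (auto simp: Lp_space_def)
qed

text \<open>This rests on the interval having positive measure: over a null space the essential
  supremum would be -\<infinity>.\<close>

lemma esssup_abs_nonneg:
  assumes [measurable]: "f \<in> borel_measurable unit_leb"
  shows "0 \<le> esssup unit_leb (\<lambda>x. ereal \<bar>f x\<bar>)"
proof -
  have "esssup unit_leb (\<lambda>x. ereal 0) \<le> esssup unit_leb (\<lambda>x. ereal \<bar>f x\<bar>)"
    by (intro esssup_mono) auto
  also have "esssup unit_leb (\<lambda>x. ereal 0) = 0"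
    by (subst esssup_const) (auto simp: emeasure_restrict_space)
  finally show ?thesis .
qed

text \<open>Membership gives finiteness of the essential supremum, without which
  \<open>real_of_ereal\<close> would report the norm 0. Being finite, it can be read back from the
  real norm, and all later sup-norm arguments become almost-everywhere bounds.\<close>

lemma Lp_inf_norm_le_iff:
  assumes "f \<in> Lp_space \<infinity>"
  shows "Lp_norm \<infinity> f \<le> c \<longleftrightarrow> (AE x in unit_leb. \<bar>f x\<bar> \<le> c)"
proof -
  let ?E = "esssup unit_leb (\<lambda>x. ereal \<bar>f x\<bar>)"
  have [measurable]: "f \<in> borel_measurable unit_leb" using assms by (rule Lp_space_measurable)
  have "?E < \<infinity>" "0 \<le> ?E" using assms esssup_abs_nonneg[of f] by (auto simp: Lp_space_def)
  then have E: "?E = ereal (Lp_norm \<infinity> f)"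
    by (cases ?E) (auto simp: Lp_norm_def)
  show ?thesis
  proof
    assume le: "Lp_norm \<infinity> f \<le> c"
    have "AE x in unit_leb. ereal \<bar>f x\<bar> \<le> ?E" by (rule esssup_AE)
    then show "AE x in unit_leb. \<bar>f x\<bar> \<le> c"
      by eventually_elim (use le E in auto)
  next
    assume "AE x in unit_leb. \<bar>f x\<bar> \<le> c"
    then have "?E \<le> ereal c" by (intro esssup_I) auto
    then show "Lp_norm \<infinity> f \<le> c" using E by simp
  qed
qed

lemma Lp_norm_nonneg:
  assumes "f \<in> Lp_space q" shows "0 \<le> Lp_norm q f"
proof (cases "q = \<infinity>")
  case True
  then show ?thesis
    using esssup_abs_nonneg[OF Lp_space_measurable[OF assms]]
    by (simp add: Lp_norm_def real_of_ereal_pos)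
qed (simp add: Lp_norm_def)

lemma Lp_norm_cong_AE:
  assumes "f \<in> borel_measurable unit_leb" "g \<in> borel_measurable unit_leb"
    and "AE x in unit_leb. f x = g x"
  shows "Lp_norm q f = Lp_norm q g"
proof -
  note [measurable] = assms(1,2)
  have "esssup unit_leb (\<lambda>x. ereal \<bar>f x\<bar>) = esssup unit_leb (\<lambda>x. ereal \<bar>g x\<bar>)"
    using assms(3) by (intro esssup_AE_cong) auto
  moreover have "(\<integral>x. \<bar>f x\<bar> powr s \<partial>unit_leb) = (\<integral>x. \<bar>g x\<bar> powr s \<partial>unit_leb)" for s
    using assms(3) by (intro integral_cong_AE) auto
  ultimately show ?thesis by (simp add: Lp_norm_def)
qed

lemma Lp_space_cmult:
  assumes "1 \<le> q" "f \<in> Lp_space q"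
  shows "(\<lambda>x. c * f x) \<in> Lp_space q"
proof (cases q)
  case (real p)
  then show ?thesis using assms by (auto simp: Lp_space_ereal abs_mult powr_mult)
next
  case PInf
  then obtain b where b: "AE x in unit_leb. \<bar>f x\<bar> \<le> b" using assms by (auto simp: Lp_inf_bounded_iff)
  have "AE x in unit_leb. \<bar>c * f x\<bar> \<le> \<bar>c\<bar> * b"
    using b by eventually_elim (auto simp: abs_mult intro: mult_left_mono)
  then show ?thesis using assms PInf by (auto simp: Lp_inf_bounded_iff)
qed (use assms in auto)

lemma Lp_norm_cmult_le:
  assumes q: "1 \<le> q" and f: "f \<in> Lp_space q"
  shows "Lp_norm q (\<lambda>x. c * f x) \<le> \<bar>c\<bar> * Lp_norm q f"
proof (cases q)
  case (real p)
  then have p: "1 \<le> p" using q by simp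
  have "(\<integral>x. \<bar>f x\<bar> powr p \<partial>unit_leb) \<le> Lp_norm q f powr p"
    using Lp_norm_le_iff[OF p Lp_norm_nonneg[OF f]] real by blast
  then show ?thesis unfolding real using Lp_norm_nonneg[OF f] real
    by (subst Lp_norm_le_iff[OF p]) (auto simp: abs_mult powr_mult intro!: mult_left_mono)
next
  case PInf
  have "AE x in unit_leb. \<bar>f x\<bar> \<le> Lp_norm \<infinity> f"
    using Lp_inf_norm_le_iff f PInf by blast
  then have "AE x in unit_leb. \<bar>c * f x\<bar> \<le> \<bar>c\<bar> * Lp_norm \<infinity> f"
    by eventually_elim (auto simp: abs_mult intro: mult_left_mono)
  then show ?thesis
    using Lp_inf_norm_le_iff Lp_space_cmult[OF q f] PInf by blast
qed (use q in auto)

text \<open>Minkowski by convexity: f/a and g/b lie in the unit ball, and (f + g)/(a + b) is their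
  convex combination with weights a/(a + b) and b/(a + b). Strictly positive majorants a, b replace
  the norms, which may vanish and cannot be divided by.\<close>

lemma Lp_add_norm_le:
  assumes p: "1 \<le> p" and f: "f \<in> Lp_space (ereal p)" and g: "g \<in> Lp_space (ereal p)"
    and ab: "a > 0" "b > 0" "Lp_norm (ereal p) f \<le> a" "Lp_norm (ereal p) g \<le> b"
  shows "(\<lambda>x. f x + g x) \<in> Lp_space (ereal p) \<and> Lp_norm (ereal p) (\<lambda>x. f x + g x) \<le> a + b"
proof -
  note [measurable] = f[THEN Lp_space_measurable] g[THEN Lp_space_measurable]
  have int: "integrable unit_leb (\<lambda>x. \<bar>f x\<bar> powr p)" "integrable unit_leb (\<lambda>x. \<bar>g x\<bar> powr p)"
    using f g by (auto simp: Lp_space_ereal)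
  have le: "(\<integral>x. \<bar>f x\<bar> powr p \<partial>unit_leb) \<le> a powr p" "(\<integral>x. \<bar>g x\<bar> powr p \<partial>unit_leb) \<le> b powr p"
    using ab p Lp_norm_le_iff[OF p] by (auto simp: less_imp_le)
  define s t where "s = a / (a + b)" and "t = b / (a + b)"
  have st: "0 \<le> s" "0 \<le> t" "s + t = 1"
    using ab by (auto simp: s_def t_def add_divide_distrib[symmetric])
  define H where "H x = (a + b) powr p * (s / a powr p * \<bar>f x\<bar> powr p + t / b powr p * \<bar>g x\<bar> powr p)" for x
  have intH: "integrable unit_leb H" unfolding H_def using int by auto
  have bound: "\<bar>f x + g x\<bar> powr p \<le> H x" for x
  proof -
    have "\<bar>f x + g x\<bar> powr p \<le> (\<bar>f x\<bar> + \<bar>g x\<bar>) powr p"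
      using p by (intro powr_mono2) auto
    also have "\<bar>f x\<bar> + \<bar>g x\<bar> = (a + b) * (s * (\<bar>f x\<bar> / a) + t * (\<bar>g x\<bar> / b))"
      using ab by (simp add: s_def t_def distrib_left)
    also have "\<dots> powr p = (a + b) powr p * (s * (\<bar>f x\<bar> / a) + t * (\<bar>g x\<bar> / b)) powr p"
      by (rule powr_mult)
    also have "\<dots> \<le> (a + b) powr p * (s * (\<bar>f x\<bar> / a) powr p + t * (\<bar>g x\<bar> / b) powr p)"
      using st ab p by (intro mult_left_mono powr_convex_combination) auto
    also have "\<dots> = H x" using ab by (simp add: H_def powr_divide)
    finally show ?thesis .
  qed
  have int': "integrable unit_leb (\<lambda>x. \<bar>f x + g x\<bar> powr p)"
    by (rule Bochner_Integration.integrable_bound[OF intH])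
      (use bound in \<open>auto intro: order_trans[OF _ abs_ge_self]\<close>)
  have "(\<integral>x. \<bar>f x + g x\<bar> powr p \<partial>unit_leb) \<le> (\<integral>x. H x \<partial>unit_leb)"
    using int' intH bound by (rule integral_mono)
  also have "\<dots> = (a + b) powr p * (s / a powr p * (\<integral>x. \<bar>f x\<bar> powr p \<partial>unit_leb)
      + t / b powr p * (\<integral>x. \<bar>g x\<bar> powr p \<partial>unit_leb))"
    unfolding H_def using int by simp
  also have "\<dots> \<le> (a + b) powr p * (s / a powr p * a powr p + t / b powr p * b powr p)"
    using le st ab by (intro mult_left_mono add_mono) auto
  also have "\<dots> = (a + b) powr p" using ab st by simp
  finally show ?thesis using int' ab p by (auto simp: Lp_space_ereal Lp_norm_le_iff)
qed

lemma Lp_space_add: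
  assumes "1 \<le> q" "f \<in> Lp_space q" "g \<in> Lp_space q"
  shows "(\<lambda>x. f x + g x) \<in> Lp_space q"
proof (cases q)
  case (real p)
  then show ?thesis using assms
      Lp_add_norm_le[of p f g "\<bar>Lp_norm q f\<bar> + 1" "\<bar>Lp_norm q g\<bar> + 1"]
    by auto
next
  case PInf
  then obtain a b where "AE x in unit_leb. \<bar>f x\<bar> \<le> a" "AE x in unit_leb. \<bar>g x\<bar> \<le> b"
    using assms by (auto simp: Lp_inf_bounded_iff)
  then have "AE x in unit_leb. \<bar>f x + g x\<bar> \<le> a + b" by eventually_elim auto
  then show ?thesis using assms PInf by (auto simp: Lp_inf_bounded_iff)
qed (use assms in auto)

lemma Lp_norm_triangle:
  assumes q: "1 \<le> q" and f: "f \<in> Lp_space q" and g: "g \<in> Lp_space q"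
  shows "Lp_norm q (\<lambda>x. f x + g x) \<le> Lp_norm q f + Lp_norm q g"
proof (cases q)
  case (real p)
  show ?thesis
  proof (rule field_le_epsilon)
    fix e :: real assume "e > 0"
    \<comment> \<open>Adding e/2 makes both majorants positive even when a norm is zero.\<close>
    then have "Lp_norm q (\<lambda>x. f x + g x) \<le> (Lp_norm q f + e / 2) + (Lp_norm q g + e / 2)"
      using Lp_add_norm_le[of p f g "Lp_norm q f + e / 2" "Lp_norm q g + e / 2"]
        Lp_norm_nonneg[OF f] Lp_norm_nonneg[OF g] q f g real by auto
    then show "Lp_norm q (\<lambda>x. f x + g x) \<le> Lp_norm q f + Lp_norm q g + e" by simp
  qed
next
  case PInf
  then have "AE x in unit_leb. \<bar>f x\<bar> \<le> Lp_norm q f" "AE x in unit_leb. \<bar>g x\<bar> \<le> Lp_norm q g"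
    using Lp_inf_norm_le_iff f g by blast+
  then have "AE x in unit_leb. \<bar>f x + g x\<bar> \<le> Lp_norm q f + Lp_norm q g" by eventually_elim auto
  then show ?thesis using Lp_space_add[OF q f g] PInf by (simp add: Lp_inf_norm_le_iff)
qed (use q in auto)

lemma Lp_space_diff:
  assumes "1 \<le> q" "f \<in> Lp_space q" "g \<in> Lp_space q"
  shows "(\<lambda>x. f x - g x) \<in> Lp_space q"
  using Lp_space_add[OF assms(1,2) Lp_space_cmult[OF assms(1,3), of "-1"]] by simp

lemma Lp_norm_diff_triangle:
  assumes "1 \<le> q" "f \<in> Lp_space q" "g \<in> Lp_space q"
  shows "Lp_norm q (\<lambda>x. f x - g x) \<le> Lp_norm q f + Lp_norm q g"
  using Lp_norm_triangle[OF assms(1,2) Lp_space_cmult[OF assms(1,3), of "-1"]]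
    Lp_norm_cmult_le[OF assms(1,3), of "-1"] by simp

lemma Lp_inf_subset:
  assumes p: "1 \<le> p" and f: "f \<in> Lp_space \<infinity>"
  shows "f \<in> Lp_space (ereal p)" "Lp_norm (ereal p) f \<le> Lp_norm \<infinity> f"
proof -
  let ?c = "Lp_norm \<infinity> f"
  note [measurable] = f[THEN Lp_space_measurable]
  have "AE x in unit_leb. \<bar>f x\<bar> \<le> ?c" using f Lp_inf_norm_le_iff by blast
  then have b: "AE x in unit_leb. \<bar>f x\<bar> powr p \<le> ?c powr p"
    by eventually_elim (use p in \<open>auto intro: powr_mono2\<close>)
  have int: "integrable unit_leb (\<lambda>x. \<bar>f x\<bar> powr p)"
    using b by (intro unit_leb.integrable_const_bound[where B = "?c powr p"]) auto
  then show "f \<in> Lp_space (ereal p)" by (simp add: Lp_space_ereal)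
  have "(\<integral>x. \<bar>f x\<bar> powr p \<partial>unit_leb) \<le> (\<integral>x. ?c powr p \<partial>unit_leb)"
    using int b by (intro integral_mono_AE) auto
  then show "Lp_norm (ereal p) f \<le> ?c"
    using unit_leb.prob_space by (simp add: Lp_norm_le_iff[OF p Lp_norm_nonneg[OF f]])
qed

lemma Lp_space_imp_integrable:
  assumes p: "1 \<le> p" and f: "f \<in> Lp_space (ereal p)"
  shows "integrable unit_leb f"
proof (rule Bochner_Integration.integrable_bound)
  show "integrable unit_leb (\<lambda>x. 1 + \<bar>f x\<bar> powr p)" using f by (auto simp: Lp_space_ereal)
  have "\<bar>f x\<bar> \<le> 1 + \<bar>f x\<bar> powr p" for x
  proof (cases "\<bar>f x\<bar> \<le> 1")
    case False
    then have "\<bar>f x\<bar> powr 1 \<le> \<bar>f x\<bar> powr p" using p by (intro powr_mono) auto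
    then show ?thesis using False by simp
  qed (simp add: add_increasing2)
  then show "AE x in unit_leb. norm (f x) \<le> norm (1 + \<bar>f x\<bar> powr p)" by simp
qed (rule Lp_space_measurable[OF f])

section \<open>Growth of the norm along a curve\<close>

text \<open>Consider the last time at which g lies below the line of slope C + e. If it came before
  t, the one-sided estimate there would keep g below the line a little longer. The slack e is then
  sent to 0.\<close>

lemma dini_growth:
  fixes g :: "real \<Rightarrow> real"
  assumes cont: "continuous_on {0..T} g"
    and dini: "\<And>t e. \<lbrakk>0 \<le> t; t < T; e > 0\<rbrakk> \<Longrightarrow>
      eventually (\<lambda>s. g s \<le> g t + (C + e) * (s - t)) (at_right t)"
    and t: "t \<in> {0..T}"
  shows "g t \<le> g 0 + C * t"
proof (rule field_le_epsilon)
  fix e' :: real assume e': "e' > 0"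
  \<comment> \<open>The total slack e * t stays below e'; the divisor t + 1 avoids division by zero
    at t = 0.\<close>
  define e where "e = e' / (t + 1)"
  have e: "e > 0" using e' t by (simp add: e_def)
  let ?l = "\<lambda>s. g 0 + (C + e) * s"
  have "g t \<le> ?l t"
  proof (rule ccontr)
    assume neg: "\<not> g t \<le> ?l t"
    define S where "S = {s \<in> {0..t}. g s - ?l s \<le> 0}"
    have "continuous_on {0..t} (\<lambda>s. g s - ?l s)"
      using t by (intro continuous_intros continuous_on_subset[OF cont]) auto
    then have "closed ({0..t} \<inter> (\<lambda>s. g s - ?l s) -` {..0})"
      by (intro continuous_closed_preimage) auto
    moreover have "{0..t} \<inter> (\<lambda>s. g s - ?l s) -` {..0} = S" by (auto simp: S_def)
    ultimately have "closed S" by simp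
    moreover have "bounded S"
      by (rule bounded_subset[OF bounded_closed_interval[of 0 t]]) (auto simp: S_def)
    \<comment> \<open>Continuity of g makes S closed, so the last good time is attained and the line
      bound still holds there.\<close>
    ultimately have "compact S" by (simp add: compact_eq_bounded_closed)
    moreover have "0 \<in> S" using t by (auto simp: S_def)
    ultimately obtain a where a: "a \<in> S" "\<And>s. s \<in> S \<Longrightarrow> s \<le> a"
      using compact_attains_sup[of S] by blast
    have at: "a \<noteq> t" "0 \<le> a" "a \<le> t" using a neg by (auto simp: S_def)
    then have "eventually (\<lambda>s. g s \<le> g a + (C + e) * (s - a)) (at_right a)"
      using t e by (intro dini) auto
    moreover have "eventually (\<lambda>s. s \<in> {a<..<t}) (at_right a)"
      using at by (intro eventually_at_right_real) auto
    ultimately have "eventually (\<lambda>s. s \<in> S \<and> a < s) (at_right a)"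
    proof eventually_elim
      case (elim s)
      then have "g s \<le> ?l a + (C + e) * (s - a)" using a by (auto simp: S_def)
      also have "\<dots> = ?l s" by (simp add: algebra_simps)
      finally show ?case using elim at by (auto simp: S_def)
    qed
    then show False
      using a(2) eventually_happens[of _ "at_right a"] trivial_limit_at_right_real by force
  qed
  also have "?l t \<le> g 0 + C * t + e'"
  proof -
    have "e * t \<le> e * (t + 1)" using e by simp
    also have "\<dots> = e'" using t by (simp add: e_def)
    finally show ?thesis by (simp add: algebra_simps)
  qed
  finally show "g t \<le> g 0 + C * t + e'" .
qed

text \<open>The curve differs from its Euler step of length s - t by (s - t) R, where the norm of R
  tends to 0. So a bound on Euler steps becomes a right Dini estimate with slope C + e. It serves
  twice: q = \<infinity> with C = 0 for the maximum principle, and finite q for the error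
  estimate.\<close>

lemma Lp_norm_growth:
  assumes q: "1 \<le> q" and C1: "C1_Lp q T v v'"
    and step: "\<And>t h. \<lbrakk>t \<in> {0..T}; 0 < h; h \<le> 1\<rbrakk> \<Longrightarrow>
      Lp_norm q (\<lambda>x. v t x + h * v' t x) \<le> Lp_norm q (v t) + h * C"
    and t: "t \<in> {0..T}"
  shows "Lp_norm q (v t) \<le> Lp_norm q (v 0) + C * t"
proof (rule dini_growth[OF _ _ t])
  define R where "R t s x = (v s x - v t x) / (s - t) - v' t x" for t s x
  have vS: "v s \<in> Lp_space q" "v' s \<in> Lp_space q" if "s \<in> {0..T}" for s
    using C1 that by (auto simp: C1_Lp_def)
  have lim: "((\<lambda>s. Lp_norm q (R t s)) \<longlongrightarrow> 0) (at t within {0..T})" if "t \<in> {0..T}" for t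
    using C1 that unfolding R_def by (auto simp: C1_Lp_def)
  \<comment> \<open>The case s = t is included: division by zero is zero, so \<open>R t t\<close> is
    just - v' t.\<close>
  have RS: "R t s \<in> Lp_space q" if "s \<in> {0..T}" "t \<in> {0..T}" for s t
  proof -
    have "(\<lambda>x. (1 / (s - t)) * (v s x - v t x) - v' t x) \<in> Lp_space q"
      using that by (intro Lp_space_diff Lp_space_cmult q vS)
    then show ?thesis by (simp add: R_def[abs_def])
  qed
  have v_eq: "v s x = v t x + (s - t) * (v' t x + R t s x)" if "s \<noteq> t" for s t x
    using that by (simp add: R_def)
  show "continuous_on {0..T} (\<lambda>t. Lp_norm q (v t))"
    unfolding continuous_on_def
  proof
    fix t assume t: "t \<in> {0..T}"
    have bound: "\<bar>Lp_norm q (v s) - Lp_norm q (v t)\<bar> \<le> \<bar>s - t\<bar> * (Lp_norm q (v' t) + Lp_norm q (R t s))"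
      if s: "s \<in> {0..T}" "s \<noteq> t" for s
    proof -
      define D where "D = (\<lambda>x. (s - t) * (v' t x + R t s x))"
      have DS: "D \<in> Lp_space q"
        unfolding D_def using s t by (intro Lp_space_cmult Lp_space_add q vS RS)
      have "Lp_norm q D \<le> \<bar>s - t\<bar> * Lp_norm q (\<lambda>x. v' t x + R t s x)"
        unfolding D_def using s t by (intro Lp_norm_cmult_le Lp_space_add q vS RS)
      also have "\<dots> \<le> \<bar>s - t\<bar> * (Lp_norm q (v' t) + Lp_norm q (R t s))"
        using s t by (intro mult_left_mono Lp_norm_triangle q vS RS) auto
      finally have D: "Lp_norm q D \<le> \<bar>s - t\<bar> * (Lp_norm q (v' t) + Lp_norm q (R t s))" .
      have "v s = (\<lambda>x. v t x + D x)" "v t = (\<lambda>x. v s x - D x)"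
        using v_eq[OF s(2)] by (auto simp: D_def)
      then have "Lp_norm q (v s) \<le> Lp_norm q (v t) + Lp_norm q D"
          "Lp_norm q (v t) \<le> Lp_norm q (v s) + Lp_norm q D"
        using Lp_norm_triangle[OF q vS(1)[OF t] DS] Lp_norm_diff_triangle[OF q vS(1)[OF s(1)] DS]
        by simp_all
      with D show ?thesis by linarith
    qed
    have "((\<lambda>s. \<bar>s - t\<bar> * (Lp_norm q (v' t) + Lp_norm q (R t s))) \<longlongrightarrow> \<bar>t - t\<bar> * (Lp_norm q (v' t) + 0))
        (at t within {0..T})"
      by (intro tendsto_intros lim t)
    then have "((\<lambda>s. \<bar>s - t\<bar> * (Lp_norm q (v' t) + Lp_norm q (R t s))) \<longlongrightarrow> 0) (at t within {0..T})"
      by simp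
    then have "((\<lambda>s. Lp_norm q (v s) - Lp_norm q (v t)) \<longlongrightarrow> 0) (at t within {0..T})"
      by (rule Lim_null_comparison[rotated])
        (auto simp: eventually_at_filter intro!: always_eventually bound)
    then show "((\<lambda>t. Lp_norm q (v t)) \<longlongrightarrow> Lp_norm q (v t)) (at t within {0..T})"
      by (simp add: LIM_zero_iff)
  qed
  fix t e :: real assume t: "0 \<le> t" "t < T" and e: "e > 0"
  have tT: "t \<in> {0..T}" using t by simp
  have "at_right t \<le> at t within {t..T} "
    using t by (simp add: at_within_Icc_at_right)
  also have "\<dots> \<le> at t within {0..T}" using t by (intro at_le) auto
  finally have le: "at_right t \<le> at t within {0..T}" .
  have "eventually (\<lambda>s. Lp_norm q (R t s) < e) (at t within {0..T})"
    using lim[OF tT] e by (rule order_tendstoD)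
  then have "eventually (\<lambda>s. Lp_norm q (R t s) < e) (at_right t)"
    by (rule filter_leD[OF le])
  \<comment> \<open>The cap t + 1 keeps the Euler step length s - t at most 1, as
    \<open>step\<close> demands.\<close>
  moreover have "eventually (\<lambda>s. s \<in> {t<..<min T (t + 1)}) (at_right t)"
    using t by (intro eventually_at_right_real) auto
  ultimately show "eventually (\<lambda>s. Lp_norm q (v s) \<le> Lp_norm q (v t) + (C + e) * (s - t)) (at_right t)"
  proof eventually_elim
    case (elim s)
    then have s: "s \<in> {0..T}" "0 < s - t" "s - t \<le> 1" "s \<noteq> t" using t by auto
    have "Lp_norm q (v s) = Lp_norm q (\<lambda>x. (v t x + (s - t) * v' t x) + (s - t) * R t s x)"
      by (rule arg_cong[where f = "Lp_norm q"]) (use v_eq[OF s(4)] in \<open>auto simp: distrib_left\<close>)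
    also have "\<dots> \<le> Lp_norm q (\<lambda>x. v t x + (s - t) * v' t x) + Lp_norm q (\<lambda>x. (s - t) * R t s x)"
      by (intro Lp_norm_triangle Lp_space_add Lp_space_cmult q vS RS tT s(1))
    also have "\<dots> \<le> (Lp_norm q (v t) + (s - t) * C) + \<bar>s - t\<bar> * Lp_norm q (R t s)"
      by (intro add_mono step Lp_norm_cmult_le q RS tT s)
    also have "\<dots> \<le> (Lp_norm q (v t) + (s - t) * C) + (s - t) * e"
      using elim s by simp
    finally show ?case by (simp add: algebra_simps)
  qed
qed

section \<open>Differences of C^1 curves and passage from L^\<infinity> to L^p\<close>

lemma C1_Lp_diff:
  assumes q: "1 \<le> q" and u: "C1_Lp q T u u'" and w: "C1_Lp q T w w'"
  shows "C1_Lp q T (\<lambda>t x. u t x - w t x) (\<lambda>t x. u' t x - w' t x)"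
proof -
  have uS: "u t \<in> Lp_space q" "u' t \<in> Lp_space q" "w t \<in> Lp_space q" "w' t \<in> Lp_space q"
    if "t \<in> {0..T}" for t
    using u w that by (auto simp: C1_Lp_def)
  have squeeze: "((\<lambda>s. Lp_norm q (F s)) \<longlongrightarrow> 0) (at t within {0..T})"
    if G: "((\<lambda>s. Lp_norm q (G s)) \<longlongrightarrow> 0) (at t within {0..T})"
      and H: "((\<lambda>s. Lp_norm q (H s)) \<longlongrightarrow> 0) (at t within {0..T})"
      and S: "\<And>s. s \<in> {0..T} \<Longrightarrow> G s \<in> Lp_space q" "\<And>s. s \<in> {0..T} \<Longrightarrow> H s \<in> Lp_space q"
      and F: "\<And>s x. F s x = G s x - H s x" for F G H t
  proof (rule tendsto_sandwich)
    have F': "F s = (\<lambda>x. G s x - H s x)" for s using F by auto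
    show "eventually (\<lambda>s. 0 \<le> Lp_norm q (F s)) (at t within {0..T})"
      unfolding F' eventually_at_filter
      by (auto intro!: always_eventually Lp_norm_nonneg Lp_space_diff q S)
    show "eventually (\<lambda>s. Lp_norm q (F s) \<le> Lp_norm q (G s) + Lp_norm q (H s)) (at t within {0..T})"
      unfolding F' eventually_at_filter
      by (auto intro!: always_eventually Lp_norm_diff_triangle q S)
    show "((\<lambda>s. Lp_norm q (G s) + Lp_norm q (H s)) \<longlongrightarrow> 0) (at t within {0..T})"
      using tendsto_add[OF G H] by simp
  qed simp
  have quotient: "(\<lambda>x. (f x - g x) / c - k x) \<in> Lp_space q"
    if "f \<in> Lp_space q" "g \<in> Lp_space q" "k \<in> Lp_space q" for f g k c
  proof -
    have "(\<lambda>x. (1 / c) * (f x - g x) - k x) \<in> Lp_space q"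
      using that by (intro Lp_space_diff Lp_space_cmult q)
    then show ?thesis by simp
  qed
  show ?thesis
    unfolding C1_Lp_def
  proof (intro ballI conjI)
    fix t assume t: "t \<in> {0..T}"
    show "(\<lambda>x. u t x - w t x) \<in> Lp_space q" "(\<lambda>x. u' t x - w' t x) \<in> Lp_space q"
      using t by (intro Lp_space_diff q uS; simp)+
    show "((\<lambda>s. Lp_norm q (\<lambda>x. (u s x - w s x - (u t x - w t x)) / (s - t) - (u' t x - w' t x))) \<longlongrightarrow> 0)
        (at t within {0..T})"
      by (rule squeeze[where G = "\<lambda>s x. (u s x - u t x) / (s - t) - u' t x"
            and H = "\<lambda>s x. (w s x - w t x) / (s - t) - w' t x"])
        (use u w t in \<open>auto simp: C1_Lp_def diff_divide_distrib intro!: quotient[unfolded diff_divide_distrib]\<close>)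
    show "((\<lambda>s. Lp_norm q (\<lambda>x. u' s x - w' s x - (u' t x - w' t x))) \<longlongrightarrow> 0) (at t within {0..T})"
      by (rule squeeze[where G = "\<lambda>s x. u' s x - u' t x" and H = "\<lambda>s x. w' s x - w' t x"])
        (use u w t in \<open>auto simp: C1_Lp_def intro!: Lp_space_diff q uS\<close>)
  qed
qed

text \<open>On a probability space the L^p norm is at most the L^\<infinity> norm, so both limits
  transfer. This puts the graphon solution into the space of the graph solution, where their
  difference can be formed.\<close>

lemma C1_Lp_inf_imp:
  assumes p: "1 \<le> p" and u: "C1_Lp \<infinity> T u u'"
  shows "C1_Lp (ereal p) T u u'"
proof -
  have uS: "u t \<in> Lp_space \<infinity>" "u' t \<in> Lp_space \<infinity>" if "t \<in> {0..T}" for t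
    using u that by (auto simp: C1_Lp_def)
  have squeeze: "((\<lambda>s. Lp_norm (ereal p) (F s)) \<longlongrightarrow> 0) (at t within {0..T})"
    if G: "((\<lambda>s. Lp_norm \<infinity> (F s)) \<longlongrightarrow> 0) (at t within {0..T})"
      and S: "\<And>s. s \<in> {0..T} \<Longrightarrow> F s \<in> Lp_space \<infinity>" for F t
    by (rule tendsto_sandwich[OF _ _ tendsto_const G])
      (auto simp: eventually_at_filter intro!: always_eventually Lp_norm_nonneg Lp_inf_subset p S)
  have quotient: "(\<lambda>x. (f x - g x) / c - k x) \<in> Lp_space \<infinity>"
    if "f \<in> Lp_space \<infinity>" "g \<in> Lp_space \<infinity>" "k \<in> Lp_space \<infinity>" for f g k c
  proof -
    have "(\<lambda>x. (1 / c) * (f x - g x) - k x) \<in> Lp_space \<infinity>"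
      using that by (intro Lp_space_diff Lp_space_cmult) auto
    then show ?thesis by simp
  qed
  show ?thesis
    unfolding C1_Lp_def
  proof (intro ballI conjI)
    fix t assume t: "t \<in> {0..T}"
    show "u t \<in> Lp_space (ereal p)" "u' t \<in> Lp_space (ereal p)"
      using t by (intro Lp_inf_subset p uS; simp)+
    show "((\<lambda>s. Lp_norm (ereal p) (\<lambda>x. (u s x - u t x) / (s - t) - u' t x)) \<longlongrightarrow> 0) (at t within {0..T})"
      "((\<lambda>s. Lp_norm (ereal p) (\<lambda>x. u' s x - u' t x)) \<longlongrightarrow> 0) (at t within {0..T})"
      using u t by (intro squeeze quotient Lp_space_diff uS; simp add: C1_Lp_def)+
  qed
qed

section \<open>The Euler step in $L^p$\<close>

text \<open>With d the mass of \<kappa>, the Euler step at x is an average of f: mass 1 - h d stays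
  at x and h \<kappa> is spread over the interval. Jensen applies to this average. The right side is
  again an Euler step at x, now of |f|^p, so that integrating over x can exploit conservation of
  mass. The case p = 1 yields the maximum principle.\<close>

lemma euler_step_convex_bound:
  fixes \<kappa> f :: "real \<Rightarrow> real"
  assumes p: "1 \<le> p" and h: "0 \<le> h" "h \<le> 1"
    and \<kappa>: "\<And>y. y \<in> unit_ivl \<Longrightarrow> 0 \<le> \<kappa> y" "integrable unit_leb \<kappa>" "(\<integral>y. \<kappa> y \<partial>unit_leb) \<le> 1"
    and f: "integrable unit_leb (\<lambda>y. \<kappa> y * f y)" "integrable unit_leb (\<lambda>y. \<kappa> y * \<bar>f y\<bar> powr p)"
  shows "\<bar>f x + h * (\<integral>y. \<kappa> y * (f y - f x) \<partial>unit_leb)\<bar> powr p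
    \<le> \<bar>f x\<bar> powr p + h * (\<integral>y. \<kappa> y * (\<bar>f y\<bar> powr p - \<bar>f x\<bar> powr p) \<partial>unit_leb)"
proof -
  define d where "d = (\<integral>y. \<kappa> y \<partial>unit_leb)"
  define I where "I = (\<integral>y. \<kappa> y * \<bar>f y\<bar> \<partial>unit_leb)"
  define J where "J = (\<integral>y. \<kappa> y * \<bar>f y\<bar> powr p \<partial>unit_leb)"
  \<comment> \<open>The mean of |f| under these weights, and the point at which the tangent is
    taken.\<close>
  define m where "m = (1 - h * d) * \<bar>f x\<bar> + h * I"
  define c where "c = p * m powr (p - 1)"
  have d: "0 \<le> d" "d \<le> 1" using \<kappa> by (auto simp: d_def intro!: Bochner_Integration.integral_nonneg)
  have abs_eq: "\<bar>\<kappa> y * f y\<bar> = \<kappa> y * \<bar>f y\<bar>" if "y \<in> unit_ivl" for y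
    using \<kappa>(1)[OF that] by (simp add: abs_mult)
  have hd: "h * d \<le> 1" using d h by (metis mult_le_one)
  have absf: "integrable unit_leb (\<lambda>y. \<kappa> y * \<bar>f y\<bar>)"
  proof -
    have "integrable unit_leb (\<lambda>y. \<bar>\<kappa> y * f y\<bar>) \<longleftrightarrow> ?thesis"
      by (rule Bochner_Integration.integrable_cong) (simp_all only: space_unit_leb abs_eq)
    then show ?thesis using integrable_abs[OF f(1)] by blast
  qed
  have "(\<integral>y. \<bar>\<kappa> y * f y\<bar> \<partial>unit_leb) = I"
    unfolding I_def by (rule Bochner_Integration.integral_cong) (simp_all only: space_unit_leb abs_eq)
  then have I: "\<bar>\<integral>y. \<kappa> y * f y \<partial>unit_leb\<bar> \<le> I"
    using integral_abs_bound[of unit_leb "\<lambda>y. \<kappa> y * f y"] by simp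
  then have I0: "0 \<le> I" by (meson abs_ge_zero order_trans)
  have m0: "0 \<le> m" using hd h I I0 by (simp add: m_def)
  have "(\<integral>y. \<kappa> y * (f y - f x) \<partial>unit_leb) = (\<integral>y. \<kappa> y * f y \<partial>unit_leb) - d * f x"
    using \<kappa>(2,3) f by (simp add: right_diff_distrib d_def)
  then have "f x + h * (\<integral>y. \<kappa> y * (f y - f x) \<partial>unit_leb)
      = f x + h * ((\<integral>y. \<kappa> y * f y \<partial>unit_leb) - d * f x)"
    by simp
  also have "\<dots> = (1 - h * d) * f x + h * (\<integral>y. \<kappa> y * f y \<partial>unit_leb)"
    by (simp add: algebra_simps)
  finally have "\<bar>f x + h * (\<integral>y. \<kappa> y * (f y - f x) \<partial>unit_leb)\<bar>
      = \<bar>(1 - h * d) * f x + h * (\<integral>y. \<kappa> y * f y \<partial>unit_leb)\<bar>" by simp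
  also have "\<dots> \<le> \<bar>(1 - h * d) * f x\<bar> + \<bar>h * (\<integral>y. \<kappa> y * f y \<partial>unit_leb)\<bar>"
    by (rule abs_triangle_ineq)
  also have "\<dots> \<le> m"
    using hd h I I0 by (auto simp: m_def abs_mult intro!: mult_left_mono)
  finally have "\<bar>f x + h * (\<integral>y. \<kappa> y * (f y - f x) \<partial>unit_leb)\<bar> powr p \<le> m powr p"
    using p by (intro powr_mono2) auto
  \<comment> \<open>The terms with c cancel, since (1 - h d) (|f x| - m) + h (I - d m) = 0 by the
    choice of m; what remains is m powr p times total weight 1.\<close>
  also have "m powr p = (1 - h * d) * (m powr p + c * (\<bar>f x\<bar> - m)) + h * (d * m powr p + c * (I - d * m))"
    by (simp add: m_def algebra_simps)
  also have "\<dots> \<le> (1 - h * d) * \<bar>f x\<bar> powr p + h * J"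
  proof (intro add_mono mult_left_mono)
    show "m powr p + c * (\<bar>f x\<bar> - m) \<le> \<bar>f x\<bar> powr p"
      unfolding c_def using powr_above_tangent p m0 by simp
    have "d * m powr p + c * (I - d * m) = (\<integral>y. \<kappa> y * m powr p + c * (\<kappa> y * \<bar>f y\<bar> - \<kappa> y * m) \<partial>unit_leb)"
      using \<kappa>(2,3) absf by (simp add: d_def I_def)
    also have "\<dots> = (\<integral>y. \<kappa> y * (m powr p + c * (\<bar>f y\<bar> - m)) \<partial>unit_leb)"
      by (simp add: algebra_simps)
    also have "\<dots> \<le> J"
      unfolding J_def
    proof (rule integral_mono)
      show "integrable unit_leb (\<lambda>y. \<kappa> y * (m powr p + c * (\<bar>f y\<bar> - m)))"
        using \<kappa>(2,3) absf by (simp add: right_diff_distrib distrib_left mult.left_commute[of _ c])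
      show "\<kappa> y * (m powr p + c * (\<bar>f y\<bar> - m)) \<le> \<kappa> y * \<bar>f y\<bar> powr p" if "y \<in> space unit_leb" for y
        unfolding c_def using powr_above_tangent[of p "\<bar>f y\<bar>" m] p m0 \<kappa>(1)[of y] that by (intro mult_left_mono) simp_all
    qed (rule f)
    finally show "d * m powr p + c * (I - d * m) \<le> J" .
  qed (use hd h in auto)
  also have "\<dots> = \<bar>f x\<bar> powr p + h * (\<integral>y. \<kappa> y * (\<bar>f y\<bar> powr p - \<bar>f x\<bar> powr p) \<partial>unit_leb)"
    using \<kappa>(2,3) f by (simp add: right_diff_distrib d_def J_def algebra_simps)
  finally show ?thesis .
qed

section \<open>Mass conservation and contraction for bounded symmetric kernels\<close>

lemma diffusion_op_measurable:
  assumes [measurable]: "case_prod K \<in> borel_measurable (unit_leb \<Otimes>\<^sub>M unit_leb)"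
    "f \<in> borel_measurable unit_leb"
  shows "diffusion_op K f \<in> borel_measurable unit_leb"
  unfolding diffusion_op_def[abs_def] by measurable

lemma bounded_kernel_mult_integrable:
  fixes K :: "real \<Rightarrow> real \<Rightarrow> real" and F :: "real \<Rightarrow> real"
  assumes [measurable]: "case_prod K \<in> borel_measurable (unit_leb \<Otimes>\<^sub>M unit_leb)"
    and K: "\<And>x y. \<bar>K x y\<bar> \<le> B" and F: "integrable unit_leb F"
  shows "integrable (unit_leb \<Otimes>\<^sub>M unit_leb) (\<lambda>(x, y). K x y * F y)"
proof (rule Bochner_Integration.integrable_bound)
  have [measurable]: "F \<in> borel_measurable unit_leb" using F by auto
  show "integrable (unit_leb \<Otimes>\<^sub>M unit_leb) (\<lambda>(x, y). B * \<bar>F y\<bar>)"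
    by (intro unit_leb_pair.Fubini_integrable) (use F in auto)
  show "(\<lambda>(x, y). K x y * F y) \<in> borel_measurable (unit_leb \<Otimes>\<^sub>M unit_leb)"
    by measurable
  have "\<bar>K x y * F y\<bar> \<le> \<bar>B * \<bar>F y\<bar>\<bar>" for x y
    using K[of x y] unfolding abs_mult by (intro mult_mono) auto
  then show "AE z in unit_leb \<Otimes>\<^sub>M unit_leb. norm (case z of (x, y) \<Rightarrow> K x y * F y)
      \<le> norm (case z of (x, y) \<Rightarrow> B * \<bar>F y\<bar>)"
    by (intro always_eventually) auto
qed

text \<open>Exchanging x and y turns the loss term K(x,y) F(x) into the gain term K(x,y) F(y).
  Boundedness of K makes each term integrable on the square for F merely in L^1, so the integral may
  be split before the exchange.\<close>

lemma symmetric_kernel_conservation: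
  assumes K[measurable]: "case_prod K \<in> borel_measurable (unit_leb \<Otimes>\<^sub>M unit_leb)"
    and b: "\<And>x y. \<bar>K x y\<bar> \<le> B"
    and sym: "\<And>x y. x \<in> unit_ivl \<Longrightarrow> y \<in> unit_ivl \<Longrightarrow> K x y = K y x"
    and F: "integrable unit_leb F"
  shows "integrable unit_leb (diffusion_op K F)" "(\<integral>x. diffusion_op K F x \<partial>unit_leb) = 0"
proof -
  have [measurable]: "F \<in> borel_measurable unit_leb" using F by auto
  note 1 = bounded_kernel_mult_integrable[OF K b F]
  have "case_prod (\<lambda>x y. K y x) \<in> borel_measurable (unit_leb \<Otimes>\<^sub>M unit_leb)"
    by measurable
  from unit_leb_pair.integrable_product_swap[OF bounded_kernel_mult_integrable[OF this b F]]
  have 2: "integrable (unit_leb \<Otimes>\<^sub>M unit_leb) (\<lambda>(x, y). K x y * F x)"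
    by (simp add: case_prod_beta)
  have 3: "integrable (unit_leb \<Otimes>\<^sub>M unit_leb) (\<lambda>(x, y). K x y * (F y - F x))"
    using Bochner_Integration.integrable_diff[OF 1 2] by (simp add: case_prod_beta' right_diff_distrib)
  show "integrable unit_leb (diffusion_op K F)"
    using unit_leb_pair.integrable_fst'[OF 3] by (simp add: diffusion_op_def[abs_def])
  have "(\<integral>x. diffusion_op K F x \<partial>unit_leb) = (\<integral>(x, y). K x y * (F y - F x) \<partial>(unit_leb \<Otimes>\<^sub>M unit_leb))"
    using unit_leb_pair.integral_fst'[OF 3] by (simp add: diffusion_op_def)
  also have "\<dots> = (\<integral>(x, y). K x y * F y \<partial>(unit_leb \<Otimes>\<^sub>M unit_leb))
      - (\<integral>(x, y). K x y * F x \<partial>(unit_leb \<Otimes>\<^sub>M unit_leb))"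
    using Bochner_Integration.integral_diff[OF 1 2] by (simp add: case_prod_beta' right_diff_distrib)
  also have "(\<integral>(x, y). K x y * F x \<partial>(unit_leb \<Otimes>\<^sub>M unit_leb))
      = (\<integral>(x, y). K y x * F y \<partial>(unit_leb \<Otimes>\<^sub>M unit_leb))"
    using unit_leb_pair.integral_product_swap[of "\<lambda>(x, y). K x y * F x"] by (simp add: case_prod_beta)
  also have "\<dots> = (\<integral>(x, y). K x y * F y \<partial>(unit_leb \<Otimes>\<^sub>M unit_leb))"
    by (intro Bochner_Integration.integral_cong) (auto simp: space_pair_measure sym)
  finally show "(\<integral>x. diffusion_op K F x \<partial>unit_leb) = 0" by simp
qed

text \<open>The pointwise Jensen bound dominates the p-th power of the step by the Euler step of F =
  |f|^p; on integration the diffusion term of F disappears by conservation.\<close>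

lemma Lp_euler_step_contraction:
  assumes p: "1 \<le> p" and h: "0 \<le> h" "h \<le> 1"
    and K[measurable]: "case_prod K \<in> borel_measurable (unit_leb \<Otimes>\<^sub>M unit_leb)"
    and b: "\<And>x y. \<bar>K x y\<bar> \<le> B"
    and nonneg: "\<And>x y. x \<in> unit_ivl \<Longrightarrow> y \<in> unit_ivl \<Longrightarrow> 0 \<le> K x y"
    and sym: "\<And>x y. x \<in> unit_ivl \<Longrightarrow> y \<in> unit_ivl \<Longrightarrow> K x y = K y x"
    and deg: "AE x in unit_leb. degree K x \<le> 1"
    and f: "f \<in> Lp_space (ereal p)"
  shows "(\<lambda>x. f x + h * diffusion_op K f x) \<in> Lp_space (ereal p)"
    "Lp_norm (ereal p) (\<lambda>x. f x + h * diffusion_op K f x) \<le> Lp_norm (ereal p) f"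
proof -
  note [measurable] = Lp_space_measurable[OF f] diffusion_op_measurable[OF K Lp_space_measurable[OF f]]
  define F where "F x = \<bar>f x\<bar> powr p" for x
  have F: "integrable unit_leb F" using f by (simp add: F_def[abs_def] Lp_space_ereal)
  have f1: "integrable unit_leb f" using Lp_space_imp_integrable[OF p f] .
  note cons = symmetric_kernel_conservation[OF K b sym F, simplified]
  have bound: "AE x in unit_leb. \<bar>f x + h * diffusion_op K f x\<bar> powr p \<le> F x + h * diffusion_op K F x"
    using deg AE_space
  proof eventually_elim
    case (elim x)
    then have [measurable]: "K x \<in> borel_measurable unit_leb" by simp
    \<comment> \<open>Used for g = 1, g = f and g = F, the three integrability conditions of the
      Jensen bound.\<close>
    have int: "integrable unit_leb (\<lambda>y. K x y * g y)" if g: "integrable unit_leb g" for g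
    proof (rule Bochner_Integration.integrable_bound)
      have [measurable]: "g \<in> borel_measurable unit_leb" using g by auto
      show "(\<lambda>y. K x y * g y) \<in> borel_measurable unit_leb" by measurable
      show "integrable unit_leb (\<lambda>y. \<bar>B\<bar> * g y)" using g by simp
      show "AE y in unit_leb. norm (K x y * g y) \<le> norm (\<bar>B\<bar> * g y)"
        using order_trans[OF b[of x] abs_ge_self]
        by (simp add: abs_mult mult_right_mono)
    qed
    show ?case
      unfolding diffusion_op_def F_def using elim nonneg int[of "\<lambda>_. 1"] int[OF f1] int[OF F]
      by (intro euler_step_convex_bound p h) (auto simp: F_def degree_def)
  qed
  have intH: "integrable unit_leb (\<lambda>x. F x + h * diffusion_op K F x)" using F cons by auto
  have int: "integrable unit_leb (\<lambda>x. \<bar>f x + h * diffusion_op K f x\<bar> powr p)"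
    by (rule Bochner_Integration.integrable_bound[OF intH]) (use bound in auto)
  then show "(\<lambda>x. f x + h * diffusion_op K f x) \<in> Lp_space (ereal p)"
    by (auto simp: Lp_space_ereal)
  have "(\<integral>x. \<bar>f x + h * diffusion_op K f x\<bar> powr p \<partial>unit_leb) \<le> (\<integral>x. F x + h * diffusion_op K F x \<partial>unit_leb)"
    using int intH bound by (rule integral_mono_AE)
  also have "\<dots> = (\<integral>x. F x \<partial>unit_leb)" using F cons by simp
  finally show "Lp_norm (ereal p) (\<lambda>x. f x + h * diffusion_op K f x) \<le> Lp_norm (ereal p) f"
    unfolding Lp_norm_ereal F_def using p by (intro powr_mono2) (auto intro!: integral_nonneg_AE)
qed

section \<open>Step graphons as bounded product-measurable kernels\<close>

lemma step_graphon_measurable: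
  "case_prod (step_graphon n A) \<in> borel_measurable (unit_leb \<Otimes>\<^sub>M unit_leb)"
proof -
  have [measurable]: "(indicator (node_ivl n i) :: real \<Rightarrow> real) \<in> borel_measurable unit_leb" for i
    by (intro measurable_restrict_space1 measurable_completion) (auto simp: node_ivl_def)
  show ?thesis unfolding step_graphon_def by measurable
qed

lemma step_graphon_bounded: "\<bar>step_graphon n A x y\<bar> \<le> (\<Sum>i=1..n. \<Sum>j=1..n. \<bar>A i j\<bar>)"
  unfolding step_graphon_def
  by (intro order_trans[OF sum_abs] sum_mono) (auto simp: indicator_def)

section \<open>The cut norm\<close>

lemma AE_unit_lebI:
  assumes "AE x in lborel. P x"
  shows "AE x in unit_leb. P x"
  using AE_completion[OF assms] by (subst AE_restrict_space_iff) auto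

text \<open>Completeness of Lebesgue measure, brought to the interval by extending both functions by
  zero.\<close>

lemma borel_measurable_unit_leb_AE:
  fixes f g :: "real \<Rightarrow> real"
  assumes g: "g \<in> borel_measurable unit_leb" and ae: "AE x in unit_leb. f x = g x"
  shows "f \<in> borel_measurable unit_leb"
proof -
  have "(\<lambda>x. indicator unit_ivl x *\<^sub>R g x) \<in> borel_measurable lebesgue"
    using g by (subst (asm) borel_measurable_restrict_space_iff) auto
  moreover have "AE x in lebesgue. indicator unit_ivl x *\<^sub>R g x = indicator unit_ivl x *\<^sub>R f x"
    using ae by (subst (asm) AE_restrict_space_iff) (auto simp: indicator_def elim: eventually_mono)
  ultimately have "(\<lambda>x. indicator unit_ivl x *\<^sub>R f x) \<in> borel_measurable lebesgue"
    by (rule borel_measurable_AE)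
  then show ?thesis
    by (subst borel_measurable_restrict_space_iff) auto
qed

text \<open>The point is that f carries no measurability assumption: it will be a section of a
  graphon, or an integral over such sections, whose measurability is not known beforehand.\<close>

lemma unit_leb_cong_AE:
  fixes f g :: "real \<Rightarrow> real"
  assumes g: "g \<in> borel_measurable unit_leb" and ae: "AE x in unit_leb. f x = g x"
  shows "(\<integral>x. f x \<partial>unit_leb) = (\<integral>x. g x \<partial>unit_leb)"
    and "integrable unit_leb f \<longleftrightarrow> integrable unit_leb g"
  using integral_cong_AE[OF borel_measurable_unit_leb_AE[OF assms] g ae]
    integrable_cong_AE[OF borel_measurable_unit_leb_AE[OF assms] g ae] by auto

lemma nn_integral_unit_leb_le:
  assumes "f \<in> borel_measurable borel"
  shows "(\<integral>\<^sup>+x. f x \<partial>unit_leb) \<le> (\<integral>\<^sup>+x. f x \<partial>lborel)"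
proof -
  have "(\<integral>\<^sup>+x. f x \<partial>unit_leb) = (\<integral>\<^sup>+x. f x * indicator unit_ivl x \<partial>lebesgue)"
    by (intro nn_integral_restrict_space) auto
  also have "\<dots> \<le> (\<integral>\<^sup>+x. f x \<partial>lebesgue)"
    by (intro nn_integral_mono) (auto simp: indicator_def)
  also have "\<dots> = (\<integral>\<^sup>+x. f x \<partial>lborel)"
    by (rule nn_integral_completion)
  finally show ?thesis .
qed

text \<open>A Lebesgue measurable function on the square need not be measurable for the product
  \<open>\<sigma>\<close>-algebra, so Fubini's theorem is applied to a Borel representative.\<close>

lemma unit_square_borel_representative:
  fixes F :: "real \<Rightarrow> real \<Rightarrow> real"
  assumes F: "integrable (lebesgue_on (unit_ivl \<times> unit_ivl)) (\<lambda>(x, y). F x y)"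
  obtains G where "integrable (unit_leb \<Otimes>\<^sub>M unit_leb) (\<lambda>(x, y). G x y)"
    "AE x in unit_leb. AE y in unit_leb. F x y = G x y"
proof -
  let ?S = "unit_ivl \<times> unit_ivl"
  define H where "H z = indicator ?S z *\<^sub>R (case z of (x, y) \<Rightarrow> F x y)" for z
  have "?S \<in> sets lborel" unfolding sets_lborel by (intro borel_open open_Times open_greaterThanLessThan)
  then have S: "?S \<inter> space lebesgue \<in> sets lebesgue" by simp
  have H: "integrable lebesgue H"
    using F unfolding H_def integrable_restrict_space[OF S] .
  then have "H \<in> borel_measurable lebesgue" by (rule borel_measurable_integrable)
  then obtain G where G: "G \<in> borel_measurable lborel" "AE z in lborel. H z = G z"
    using completion_ex_borel_measurable_real by blast
  then have G_borel[measurable]: "G \<in> borel_measurable borel" by simp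
  have "integrable lebesgue G"
  proof (rule integrable_cong_AE_imp[OF H])
    show "G \<in> borel_measurable lebesgue" using G(1) by (rule measurable_completion)
    show "AE z in lebesgue. H z = G z" using G(2) by (rule AE_completion)
  qed
  then have Gint: "integrable lborel G" unfolding integrable_completion[OF G(1)] .
  \<comment> \<open>Borel measurability, unlike Lebesgue measurability, passes to the product,
    because the Borel sets of the plane are those of \<open>borel \<Otimes>\<^sub>M borel\<close>
    and the identity is measurable from \<open>unit_leb\<close> to \<open>borel\<close>.\<close>
  have G_pair: "G \<in> borel_measurable (unit_leb \<Otimes>\<^sub>M unit_leb)"
  proof -
    have "id \<in> unit_leb \<rightarrow>\<^sub>M (borel :: real measure)"
      by (intro measurable_restrict_space1 measurable_completion) simp
    then have "(\<lambda>z. (id (fst z), id (snd z))) \<in> unit_leb \<Otimes>\<^sub>M unit_leb \<rightarrow>\<^sub>M (borel \<Otimes>\<^sub>M borel :: (real \<times> real) measure)"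
      by (intro measurable_Pair measurable_compose[OF measurable_fst] measurable_compose[OF measurable_snd])
    then have "id \<in> unit_leb \<Otimes>\<^sub>M unit_leb \<rightarrow>\<^sub>M (borel :: (real \<times> real) measure)"
      by (simp add: borel_prod id_def)
    from measurable_compose[OF this G_borel] show ?thesis by simp
  qed
  have G_int: "integrable (unit_leb \<Otimes>\<^sub>M unit_leb) G"
  proof (rule integrableI_bounded[OF G_pair])
    have "(\<integral>\<^sup>+z. norm (G z) \<partial>(unit_leb \<Otimes>\<^sub>M unit_leb)) = (\<integral>\<^sup>+x. \<integral>\<^sup>+y. norm (G (x, y)) \<partial>unit_leb \<partial>unit_leb)"
      using G_pair by (subst unit_leb.nn_integral_fst[symmetric]) auto
    \<comment> \<open>Only finiteness is at stake, so both integrations may be enlarged to the whole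
      line.\<close>
    also have "\<dots> \<le> (\<integral>\<^sup>+x. \<integral>\<^sup>+y. norm (G (x, y)) \<partial>lborel \<partial>unit_leb)"
      by (intro nn_integral_mono nn_integral_unit_leb_le) (simp add: borel_prod[symmetric])
    also have "\<dots> \<le> (\<integral>\<^sup>+x. \<integral>\<^sup>+y. norm (G (x, y)) \<partial>lborel \<partial>lborel)"
      by (intro nn_integral_unit_leb_le) (simp add: borel_prod[symmetric])
    also have "\<dots> = (\<integral>\<^sup>+z. norm (G z) \<partial>(lborel \<Otimes>\<^sub>M lborel))"
      by (subst lborel.nn_integral_fst[symmetric]) (auto simp: lborel_prod)
    also have "\<dots> < \<infinity>" using Gint by (simp add: lborel_prod integrable_iff_bounded)
    finally show "(\<integral>\<^sup>+z. norm (G z) \<partial>(unit_leb \<Otimes>\<^sub>M unit_leb)) < \<infinity>" .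
  qed
  have FG: "AE x in unit_leb. AE y in unit_leb. F x y = G (x, y)"
  proof -
    have "AE z in lborel \<Otimes>\<^sub>M lborel. H z = G z" using G(2) by (subst lborel_prod)
    then have "AE x in lborel. AE y in lborel. H (x, y) = G (x, y)"
      by (rule lborel_pair.AE_pair)
    then have "AE x in unit_leb. AE y in lborel. H (x, y) = G (x, y)" by (rule AE_unit_lebI)
    then show ?thesis
      using AE_space
    proof eventually_elim
      case (elim x)
      have "AE y in unit_leb. H (x, y) = G (x, y)" using elim(1) by (rule AE_unit_lebI)
      then show ?case using AE_space
        by eventually_elim (use elim(2) in \<open>auto simp: H_def\<close>)
    qed
  qed
  show thesis
  proof (rule that)
    show "integrable (unit_leb \<Otimes>\<^sub>M unit_leb) (\<lambda>(x, y). G (x, y))"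
      using G_int by simp
  qed (rule FG)
qed

text \<open>The class containing differences of graphons, which are neither nonnegative nor graphons
  in general. Symmetry is kept because sections are controlled in the second argument while
  \<open>cut_norm\<close> integrates the first argument inside.\<close>

definition symmetric_kernel :: "(real \<Rightarrow> real \<Rightarrow> real) \<Rightarrow> bool" where
  "symmetric_kernel V \<longleftrightarrow> integrable (lebesgue_on (unit_ivl \<times> unit_ivl)) (\<lambda>(x, y). V x y) \<and>
     (\<forall>x\<in>unit_ivl. \<forall>y\<in>unit_ivl. V x y = V y x)"

lemma graphonD:
  assumes "graphon W"
  shows "integrable (lebesgue_on (unit_ivl \<times> unit_ivl)) (\<lambda>(x, y). W x y)"
    and "x \<in> unit_ivl \<Longrightarrow> y \<in> unit_ivl \<Longrightarrow> W x y = W y x"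
    and "x \<in> unit_ivl \<Longrightarrow> y \<in> unit_ivl \<Longrightarrow> 0 \<le> W x y"
    and "AE x in unit_leb. degree W x \<le> 1"
proof -
  note * = assms[unfolded graphon_def]
  show "integrable (lebesgue_on (unit_ivl \<times> unit_ivl)) (\<lambda>(x, y). W x y)"
    by (rule conjunct1[OF *])
  show "AE x in unit_leb. degree W x \<le> 1"
    by (rule conjunct2[OF conjunct2[OF *]])
  show "W x y = W y x" "0 \<le> W x y" if "x \<in> unit_ivl" "y \<in> unit_ivl"
    by (rule conjunct1[OF bspec[OF bspec[OF conjunct1[OF conjunct2[OF *]] that(1)] that(2)]]
        conjunct2[OF bspec[OF bspec[OF conjunct1[OF conjunct2[OF *]] that(1)] that(2)]])+
qed

lemma graphon_diff_symmetric_kernel: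
  assumes U: "graphon U" and W: "graphon W"
  shows "symmetric_kernel (\<lambda>x y. U x y - W x y)"
  unfolding symmetric_kernel_def
proof (intro conjI ballI)
  have "(\<lambda>(x, y). U x y - W x y) = (\<lambda>z. (case z of (x, y) \<Rightarrow> U x y) - (case z of (x, y) \<Rightarrow> W x y))"
    by (rule ext) (simp split: prod.split)
  then show "integrable (lebesgue_on (unit_ivl \<times> unit_ivl)) (\<lambda>(x, y). U x y - W x y)"
    by (simp only: Bochner_Integration.integrable_diff[OF graphonD(1)[OF U] graphonD(1)[OF W]])
  show "U x y - W x y = U y x - W y x" if "x \<in> unit_ivl" "y \<in> unit_ivl" for x y
    using graphonD(2)[OF U that] graphonD(2)[OF W that] by simp
qed

lemma integrable_section_AE:
  fixes F :: "real \<Rightarrow> real \<Rightarrow> real"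
  assumes "integrable (lebesgue_on (unit_ivl \<times> unit_ivl)) (\<lambda>(x, y). F x y)"
  shows "AE x in unit_leb. integrable unit_leb (F x)"
proof -
  obtain G where G: "integrable (unit_leb \<Otimes>\<^sub>M unit_leb) (\<lambda>(x, y). G x y)"
    and FG: "AE x in unit_leb. AE y in unit_leb. F x y = G x y"
    using unit_square_borel_representative[OF assms] .
  show ?thesis using unit_leb_pair.AE_integrable_fst'[OF G] FG
  proof eventually_elim
    case (elim x)
    then have "integrable unit_leb (G x)" by simp
    then show ?case
      using unit_leb_cong_AE(2)[OF borel_measurable_integrable elim(2)] by simp
  qed
qed

text \<open>For almost every y, symmetry turns V x y into V y x, a section that agrees with that of
  G. Hence G appears with its arguments exchanged, although G itself need not be symmetric.\<close>

lemma cut_norm_test_eq: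
  assumes V: "symmetric_kernel V"
    and G: "integrable (unit_leb \<Otimes>\<^sub>M unit_leb) (\<lambda>(x, y). G x y)"
    and VG: "AE x in unit_leb. AE y in unit_leb. V x y = G x y"
    and \<phi>[measurable]: "\<phi> \<in> borel_measurable unit_leb" and \<psi>[measurable]: "\<psi> \<in> borel_measurable unit_leb"
  shows "(\<integral>y. (\<integral>x. V x y * \<phi> x * \<psi> y \<partial>unit_leb) \<partial>unit_leb)
    = (\<integral>y. (\<integral>x. G y x * \<phi> x \<partial>unit_leb) * \<psi> y \<partial>unit_leb)"
proof (rule unit_leb_cong_AE)
  have [measurable]: "case_prod G \<in> borel_measurable (unit_leb \<Otimes>\<^sub>M unit_leb)" using G by auto
  show "(\<lambda>y. (\<integral>x. G y x * \<phi> x \<partial>unit_leb) * \<psi> y) \<in> borel_measurable unit_leb" by measurable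
  show "AE y in unit_leb. (\<integral>x. V x y * \<phi> x * \<psi> y \<partial>unit_leb) = (\<integral>x. G y x * \<phi> x \<partial>unit_leb) * \<psi> y"
    using VG AE_space
  proof eventually_elim
    case (elim y)
    then have [measurable]: "G y \<in> borel_measurable unit_leb" by simp
    have "(\<integral>x. V x y * \<phi> x * \<psi> y \<partial>unit_leb) = (\<integral>x. G y x * \<phi> x * \<psi> y \<partial>unit_leb)"
    proof (rule unit_leb_cong_AE)
      show "AE x in unit_leb. V x y * \<phi> x * \<psi> y = G y x * \<phi> x * \<psi> y"
        using elim(1) AE_space by eventually_elim (use V elim(2) in \<open>auto simp: symmetric_kernel_def\<close>)
    qed measurable
    then show ?case by simp
  qed
qed

text \<open>A real \<open>Sup\<close> is an upper bound only of a set that is bounded above; here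
  the integral of |G| over the square bounds every test value.\<close>

lemma cut_norm_upper:
  assumes V: "symmetric_kernel V"
    and \<phi>: "\<phi> \<in> borel_measurable unit_leb" "\<forall>x\<in>unit_ivl. \<phi> x \<in> {-1..1}"
    and \<psi>: "\<psi> \<in> borel_measurable unit_leb" "\<forall>y\<in>unit_ivl. \<psi> y \<in> {-1..1}"
  shows "(\<integral>y. (\<integral>x. V x y * \<phi> x * \<psi> y \<partial>unit_leb) \<partial>unit_leb) \<le> cut_norm V"
proof -
  obtain G where G: "integrable (unit_leb \<Otimes>\<^sub>M unit_leb) (\<lambda>(x, y). G x y)"
    and VG: "AE x in unit_leb. AE y in unit_leb. V x y = G x y"
    using unit_square_borel_representative[OF conjunct1[OF V[unfolded symmetric_kernel_def]]] .
  have absG: "integrable unit_leb (\<lambda>y. \<integral>x. \<bar>G y x\<bar> \<partial>unit_leb)"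
    using unit_leb_pair.integrable_fst'[OF integrable_abs[OF G]] by simp
  have bound: "(\<integral>y. (\<integral>x. V x y * a x * b y \<partial>unit_leb) \<partial>unit_leb) \<le> (\<integral>y. (\<integral>x. \<bar>G y x\<bar> \<partial>unit_leb) \<partial>unit_leb)"
    if a: "a \<in> borel_measurable unit_leb" "\<forall>x\<in>unit_ivl. a x \<in> {-1..1}"
      and b: "b \<in> borel_measurable unit_leb" "\<forall>y\<in>unit_ivl. b y \<in> {-1..1}" for a b
    unfolding cut_norm_test_eq[OF V G VG a(1) b(1)]
  proof (rule integral_mono_AE'[OF absG])
    show "AE y in unit_leb. (\<integral>x. G y x * a x \<partial>unit_leb) * b y \<le> (\<integral>x. \<bar>G y x\<bar> \<partial>unit_leb)"
      using unit_leb_pair.AE_integrable_fst'[OF G] AE_space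
    proof eventually_elim
      case (elim y)
      have le: "norm (G y x * a x) \<le> norm (G y x)" if "x \<in> space unit_leb" for x
      proof -
        have "\<bar>a x\<bar> \<le> 1" using a(2) that by (simp add: abs_le_iff minus_le_iff)
        from mult_left_le[OF this abs_ge_zero[of "G y x"]] show ?thesis by (simp add: abs_mult)
      qed
      have int: "integrable unit_leb (\<lambda>x. G y x * a x)"
        by (rule Bochner_Integration.integrable_bound[of _ "G y"]) (use elim a(1) le in auto)
      have "(\<integral>x. G y x * a x \<partial>unit_leb) * b y \<le> \<bar>\<integral>x. G y x * a x \<partial>unit_leb\<bar> * \<bar>b y\<bar>"
        by (metis abs_ge_self abs_mult)
      also have "\<dots> \<le> \<bar>\<integral>x. G y x * a x \<partial>unit_leb\<bar>"
        using b(2) elim(2) by (intro mult_left_le) (simp_all add: abs_le_iff minus_le_iff)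
      also have "\<dots> \<le> (\<integral>x. \<bar>G y x\<bar> \<partial>unit_leb)"
        using elim(1) le by (intro integral_abs_bound_integral int) (simp_all add: abs_mult)
      finally show ?case .
    qed
  qed (auto intro!: always_eventually integral_nonneg_AE)
  show ?thesis
    unfolding cut_norm_def
  proof (rule cSup_upper)
    show "bdd_above {\<integral>y. (\<integral>x. V x y * \<phi> x * \<psi> y \<partial>unit_leb) \<partial>unit_leb | \<phi> \<psi>.
     \<phi> \<in> borel_measurable unit_leb \<and> \<psi> \<in> borel_measurable unit_leb \<and>
     (\<forall>x\<in>unit_ivl. \<phi> x \<in> {-1..1}) \<and> (\<forall>y\<in>unit_ivl. \<psi> y \<in> {-1..1})}"
      by (rule bdd_aboveI) (use bound in blast)
  qed (use \<phi> \<psi> in blast)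
qed

lemma cut_norm_nonneg: "symmetric_kernel V \<Longrightarrow> 0 \<le> cut_norm V"
  using cut_norm_upper[of V "\<lambda>_. 0" "\<lambda>_. 0"] by simp

text \<open>Duality: f/M is one admissible test function, and the sign of the resulting integral is
  the other.\<close>

lemma L1_norm_le_cut_norm:
  assumes V: "symmetric_kernel V" and M: "0 < M"
    and f[measurable]: "f \<in> borel_measurable unit_leb" and fM: "AE x in unit_leb. \<bar>f x\<bar> \<le> M"
  shows "integrable unit_leb (\<lambda>x. \<integral>y. V x y * f y \<partial>unit_leb)" (is ?int)
    and "(\<integral>x. \<bar>\<integral>y. V x y * f y \<partial>unit_leb\<bar> \<partial>unit_leb) \<le> M * cut_norm V" (is ?le)
proof -
  obtain G where G: "integrable (unit_leb \<Otimes>\<^sub>M unit_leb) (\<lambda>(x, y). G x y)"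
    and VG: "AE x in unit_leb. AE y in unit_leb. V x y = G x y"
    using unit_square_borel_representative[OF conjunct1[OF V[unfolded symmetric_kernel_def]]] .
  have [measurable]: "case_prod G \<in> borel_measurable (unit_leb \<Otimes>\<^sub>M unit_leb)" using G by auto
  \<comment> \<open>The cut norm asks for values in [-1,1] everywhere, but f is bounded by M only
    almost everywhere; the exceptional values are replaced by 0.\<close>
  define \<phi> where "\<phi> y = (if \<bar>f y\<bar> \<le> M then f y / M else 0)" for y
  have [measurable]: "\<phi> \<in> borel_measurable unit_leb" unfolding \<phi>_def by measurable
  have \<phi>1: "\<bar>\<phi> y\<bar> \<le> 1" for y using M by (auto simp: \<phi>_def)
  define g where "g x = (\<integral>y. G x y * \<phi> y \<partial>unit_leb)" for x
  have [measurable]: "g \<in> borel_measurable unit_leb" unfolding g_def by measurable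
  have fg: "AE x in unit_leb. (\<integral>y. V x y * f y \<partial>unit_leb) = M * g x"
    using VG AE_space
  proof eventually_elim
    case (elim x)
    then have [measurable]: "G x \<in> borel_measurable unit_leb" by simp
    have "(\<integral>y. V x y * f y \<partial>unit_leb) = (\<integral>y. M * (G x y * \<phi> y) \<partial>unit_leb)"
    proof (rule unit_leb_cong_AE)
      show "AE y in unit_leb. V x y * f y = M * (G x y * \<phi> y)"
        using elim(1) fM by eventually_elim (use M in \<open>simp add: \<phi>_def\<close>)
    qed measurable
    then show ?case by (simp add: g_def)
  qed
  have "integrable (unit_leb \<Otimes>\<^sub>M unit_leb) (\<lambda>(x, y). G x y * \<phi> y)"
    by (rule Bochner_Integration.integrable_bound[OF G])
      (simp_all add: case_prod_beta' abs_mult mult_left_le \<phi>1)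
  from unit_leb_pair.integrable_fst'[OF this] have g_int: "integrable unit_leb g"
    by (simp add: g_def[abs_def])
  show ?int
    using g_int by (subst unit_leb_cong_AE(2)[OF _ fg]) auto
  have "(\<integral>x. \<bar>\<integral>y. V x y * f y \<partial>unit_leb\<bar> \<partial>unit_leb) = (\<integral>x. M * \<bar>g x\<bar> \<partial>unit_leb)"
    by (rule unit_leb_cong_AE) (use fg M in \<open>auto simp: abs_mult elim: eventually_mono\<close>)
  also have "\<dots> = M * (\<integral>x. g x * sgn (g x) \<partial>unit_leb)" by (simp add: abs_sgn)
  also have "(\<integral>x. g x * sgn (g x) \<partial>unit_leb) = (\<integral>y. (\<integral>x. V x y * \<phi> x * sgn (g y) \<partial>unit_leb) \<partial>unit_leb)"
    unfolding g_def by (intro cut_norm_test_eq[OF V G VG, symmetric]) (auto simp flip: g_def)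
  also have "\<dots> \<le> cut_norm V"
    using \<phi>1 by (intro cut_norm_upper[OF V]) (auto simp: abs_le_iff sgn_real_def minus_le_iff)
  finally show ?le using M by simp
qed

section \<open>Maximum principle and error estimate\<close>

text \<open>Degree at most one bounds both the integral of W f and the degree times f(x) by M,
  whence 2 M. The integrability statements allow the integral to be split into these two
  parts.\<close>

lemma graphon_section_AE:
  assumes W: "graphon W" and f[measurable]: "f \<in> borel_measurable unit_leb"
    and fM: "AE x in unit_leb. \<bar>f x\<bar> \<le> M"
  shows "AE x in unit_leb. integrable unit_leb (W x) \<and> integrable unit_leb (\<lambda>y. W x y * f y) \<and>
    \<bar>diffusion_op W f x\<bar> \<le> 2 * M"
  using integrable_section_AE[OF graphonD(1)[OF W]] graphonD(4)[OF W] fM AE_space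
proof eventually_elim
  case (elim x)
  note int = elim(1)
  then have [measurable]: "W x \<in> borel_measurable unit_leb" by (rule borel_measurable_integrable)
  have nonneg: "AE y in unit_leb. 0 \<le> W x y"
    using AE_space by eventually_elim (use graphonD(3)[OF W] elim(4) in simp)
  have M: "0 \<le> M" using elim(3) by (meson abs_ge_zero order_trans)
  have bound: "AE y in unit_leb. \<bar>W x y * f y\<bar> \<le> M * W x y"
    using nonneg fM
  proof eventually_elim
    case (elim y)
    then show ?case using mult_left_mono[of "\<bar>f y\<bar>" M "W x y"] by (simp add: abs_mult mult.commute)
  qed
  have Mint: "integrable unit_leb (\<lambda>y. M * W x y)" using int by simp
  have int_f: "integrable unit_leb (\<lambda>y. W x y * f y)"
    by (rule Bochner_Integration.integrable_bound[OF Mint]) (use bound in \<open>auto elim: eventually_mono\<close>)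
  have d: "0 \<le> degree W x" unfolding degree_def by (rule integral_nonneg_AE[OF nonneg])
  have "\<bar>\<integral>y. W x y * f y \<partial>unit_leb\<bar> \<le> (\<integral>y. \<bar>W x y * f y\<bar> \<partial>unit_leb)"
    by (rule integral_abs_bound)
  also have "\<dots> \<le> (\<integral>y. M * W x y \<partial>unit_leb)"
    by (rule integral_mono_AE[OF _ Mint bound]) (use int_f in simp)
  also have "\<dots> = M * degree W x" by (simp add: degree_def)
  also have "\<dots> \<le> M" using elim(2) M by (intro mult_left_le)
  finally have 1: "\<bar>\<integral>y. W x y * f y \<partial>unit_leb\<bar> \<le> M" .
  have "\<bar>degree W x * f x\<bar> = degree W x * \<bar>f x\<bar>" using d by (simp add: abs_mult)
  also have "\<dots> \<le> 1 * M" using elim d by (intro mult_mono) simp_all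
  finally have 2: "\<bar>degree W x * f x\<bar> \<le> M" by simp
  have "diffusion_op W f x = (\<integral>y. W x y * f y \<partial>unit_leb) - degree W x * f x"
    unfolding diffusion_op_def degree_def using int int_f by (simp add: right_diff_distrib)
  then have "\<bar>diffusion_op W f x\<bar> \<le> 2 * M" using 1 2 by linarith
  then show ?case using int int_f by blast
qed

text \<open>The convex bound with p = 1, on one section at a time, moves |f x| towards M by at most
  the fraction h times the degree of the gap M - |f x|. That fraction is at most 1, so M is not
  exceeded.\<close>

lemma graphon_euler_step_max_principle:
  assumes W: "graphon W" and f[measurable]: "f \<in> borel_measurable unit_leb"
    and fM: "AE x in unit_leb. \<bar>f x\<bar> \<le> M" and h: "0 \<le> h" "h \<le> 1"
  shows "AE x in unit_leb. \<bar>f x + h * diffusion_op W f x\<bar> \<le> M"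
  using graphon_section_AE[OF W f fM] graphonD(4)[OF W] fM AE_space
proof eventually_elim
  case (elim x)
  have int: "integrable unit_leb (W x)" "integrable unit_leb (\<lambda>y. W x y * f y)" using elim(1) by auto
  then have [measurable]: "W x \<in> borel_measurable unit_leb" by auto
  have nonneg: "0 \<le> W x y" if "y \<in> unit_ivl" for y
    using graphonD(3)[OF W] elim(4) that by simp
  have nonneg_AE: "AE y in unit_leb. 0 \<le> W x y"
    using AE_space by eventually_elim (use nonneg in simp)
  have "integrable unit_leb (\<lambda>y. \<bar>W x y * f y\<bar>)" using int(2) by simp
  then have int_abs: "integrable unit_leb (\<lambda>y. W x y * \<bar>f y\<bar>)"
    by (rule integrable_cong_AE_imp) (use nonneg_AE in \<open>auto simp: abs_mult elim: eventually_mono\<close>)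
  have "(\<integral>y. W x y * (\<bar>f y\<bar> - \<bar>f x\<bar>) \<partial>unit_leb) \<le> (\<integral>y. W x y * (M - \<bar>f x\<bar>) \<partial>unit_leb)"
  proof (rule integral_mono_AE)
    show "AE y in unit_leb. W x y * (\<bar>f y\<bar> - \<bar>f x\<bar>) \<le> W x y * (M - \<bar>f x\<bar>)"
      using fM nonneg_AE by eventually_elim (auto intro: mult_left_mono)
  qed (use int int_abs in \<open>simp_all add: right_diff_distrib\<close>)
  also have "\<dots> = degree W x * (M - \<bar>f x\<bar>)" by (simp add: degree_def)
  finally have le: "(\<integral>y. W x y * (\<bar>f y\<bar> - \<bar>f x\<bar>) \<partial>unit_leb) \<le> degree W x * (M - \<bar>f x\<bar>)" .
  have d: "0 \<le> degree W x" unfolding degree_def by (rule integral_nonneg_AE[OF nonneg_AE])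
  have "\<bar>f x + h * diffusion_op W f x\<bar> \<le> \<bar>f x\<bar> + h * (\<integral>y. W x y * (\<bar>f y\<bar> - \<bar>f x\<bar>) \<partial>unit_leb)"
    using euler_step_convex_bound[of 1 h "W x" f x, OF _ h nonneg int(1)] int elim(2) int_abs
    by (simp add: degree_def diffusion_op_def)
  also have "\<dots> \<le> \<bar>f x\<bar> + h * (degree W x * (M - \<bar>f x\<bar>))"
    using le h by (intro add_left_mono mult_left_mono)
  also have "\<dots> = \<bar>f x\<bar> + (h * degree W x) * (M - \<bar>f x\<bar>)" by simp
  also have "\<dots> \<le> \<bar>f x\<bar> + 1 * (M - \<bar>f x\<bar>)"
    using h d elim by (intro add_left_mono mult_right_mono mult_le_one) simp_all
  finally show ?case by simp
qed

text \<open>Euler steps do not increase the sup norm, so the growth lemma applies with rate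
  0.\<close>

lemma Linf_solution_bound:
  assumes W: "graphon W" and C1: "C1_Lp \<infinity> T u u'"
    and eq: "\<And>t. t \<in> {0..T} \<Longrightarrow> AE x in unit_leb. u' t x = diffusion_op W (u t) x"
    and t: "t \<in> {0..T}"
  shows "AE x in unit_leb. \<bar>u t x\<bar> \<le> Lp_norm \<infinity> (u 0)"
proof -
  have uS: "u t \<in> Lp_space \<infinity>" "u' t \<in> Lp_space \<infinity>" if "t \<in> {0..T}" for t
    using C1 that by (auto simp: C1_Lp_def)
  have "Lp_norm \<infinity> (u t) \<le> Lp_norm \<infinity> (u 0) + 0 * t"
  proof (rule Lp_norm_growth[OF _ C1 _ t])
    fix s h :: real assume s: "s \<in> {0..T}" and h: "0 < h" "h \<le> 1"
    have S: "(\<lambda>x. u s x + h * u' s x) \<in> Lp_space \<infinity>"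
      using s by (intro Lp_space_add Lp_space_cmult uS) simp_all
    have "AE x in unit_leb. \<bar>u s x\<bar> \<le> Lp_norm \<infinity> (u s)"
      using Lp_inf_norm_le_iff[OF uS(1)[OF s]] by blast
    then have "AE x in unit_leb. \<bar>u s x + h * diffusion_op W (u s) x\<bar> \<le> Lp_norm \<infinity> (u s)"
      using Lp_space_measurable[OF uS(1)[OF s]] h by (intro graphon_euler_step_max_principle[OF W]) simp_all
    then have "AE x in unit_leb. \<bar>u s x + h * u' s x\<bar> \<le> Lp_norm \<infinity> (u s)"
      using eq[OF s] by eventually_elim simp
    then show "Lp_norm \<infinity> (\<lambda>x. u s x + h * u' s x) \<le> Lp_norm \<infinity> (u s) + h * 0"
      using Lp_inf_norm_le_iff[OF S] by simp
  qed simp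
  then show ?thesis
    using Lp_inf_norm_le_iff[OF uS(1)[OF t]] by simp
qed

text \<open>With V = U - W, a = V f and b = V 1, the error is r = f b - a. The cut norm c of V
  bounds the L^1 norms of a by M c and of b by c, while r is bounded by 4 M pointwise. The estimate
  |r|^p \<le> (4 M)^(p-1) |r| combines the two kinds of bound.\<close>

lemma consistency_error_bound:
  assumes p: "1 \<le> p" and U: "graphon U" and W: "graphon W" and M: "0 < M"
    and f[measurable]: "f \<in> borel_measurable unit_leb" and fM: "AE x in unit_leb. \<bar>f x\<bar> \<le> M"
    and r[measurable]: "r \<in> borel_measurable unit_leb"
    and req: "AE x in unit_leb. r x = diffusion_op W f x - diffusion_op U f x"
  shows "r \<in> Lp_space (ereal p)"
    "Lp_norm (ereal p) r \<le> 4 * M * cut_norm (\<lambda>x y. U x y - W x y) powr (1 / p)"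
proof -
  define V where "V x y = U x y - W x y" for x y
  have V: "symmetric_kernel V"
    using graphon_diff_symmetric_kernel[OF U W] by (simp add: V_def[abs_def])
  define c where "c = cut_norm V"
  have c: "0 \<le> c" using cut_norm_nonneg[OF V] by (simp add: c_def)
  define a where "a x = (\<integral>y. V x y * f y \<partial>unit_leb)" for x
  define b where "b x = (\<integral>y. V x y * 1 \<partial>unit_leb)" for x
  have a: "integrable unit_leb a" "(\<integral>x. \<bar>a x\<bar> \<partial>unit_leb) \<le> M * c"
    using L1_norm_le_cut_norm[OF V M f fM] by (simp_all add: a_def[abs_def] c_def)
  have b: "integrable unit_leb b" "(\<integral>x. \<bar>b x\<bar> \<partial>unit_leb) \<le> c"
    using L1_norm_le_cut_norm[OF V, of 1 "\<lambda>_. 1"] by (simp_all add: b_def[abs_def] c_def)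
  have bounds: "AE x in unit_leb. \<bar>r x\<bar> \<le> 4 * M \<and> \<bar>r x\<bar> \<le> \<bar>a x\<bar> + M * \<bar>b x\<bar>"
    using req graphon_section_AE[OF U f fM] graphon_section_AE[OF W f fM] fM
  proof eventually_elim
    case (elim x)
    have "diffusion_op U f x - diffusion_op W f x = a x - f x * b x"
      using elim(2,3) unfolding diffusion_op_def a_def b_def V_def
      by (simp add: right_diff_distrib left_diff_distrib mult.commute[of _ "f x"])
    then have "r x = f x * b x - a x" using elim(1) by simp
    then have "\<bar>r x\<bar> \<le> \<bar>a x\<bar> + \<bar>f x\<bar> * \<bar>b x\<bar>"
      using abs_triangle_ineq4[of "f x * b x" "a x"] by (simp add: abs_mult)
    also have "\<dots> \<le> \<bar>a x\<bar> + M * \<bar>b x\<bar>"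
      using elim(4) by (intro add_left_mono mult_right_mono) simp_all
    finally show ?case using elim(1,2,3) by (auto simp: abs_le_iff)
  qed
  have r_inf: "r \<in> Lp_space \<infinity>"
    using bounds r by (auto simp: Lp_inf_bounded_iff intro!: exI[of _ "4 * M"] elim: eventually_mono)
  then show rS: "r \<in> Lp_space (ereal p)" by (rule Lp_inf_subset[OF p])
  define C where "C = (4 * M) powr (p - 1)"
  have C: "0 \<le> C" "C * (4 * M) = (4 * M) powr p"
    using M by (simp_all add: C_def powr_diff)
  have H: "integrable unit_leb (\<lambda>x. C * (\<bar>a x\<bar> + M * \<bar>b x\<bar>))"
    using a b by simp
  have "(\<integral>x. \<bar>r x\<bar> powr p \<partial>unit_leb) \<le> (\<integral>x. C * (\<bar>a x\<bar> + M * \<bar>b x\<bar>) \<partial>unit_leb)"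
  proof (rule integral_mono_AE[OF _ H])
    show "integrable unit_leb (\<lambda>x. \<bar>r x\<bar> powr p)" using rS by (simp add: Lp_space_ereal)
    show "AE x in unit_leb. \<bar>r x\<bar> powr p \<le> C * (\<bar>a x\<bar> + M * \<bar>b x\<bar>)"
      using bounds
    proof eventually_elim
      case (elim x)
      have "\<bar>r x\<bar> powr p = \<bar>r x\<bar> powr (p - 1) * \<bar>r x\<bar>"
        by (cases "r x = 0") (simp_all add: powr_diff)
      also have "\<dots> \<le> C * (\<bar>a x\<bar> + M * \<bar>b x\<bar>)"
        unfolding C_def using elim p by (intro mult_mono powr_mono2) simp_all
      finally show ?case .
    qed
  qed
  also have "\<dots> = C * ((\<integral>x. \<bar>a x\<bar> \<partial>unit_leb) + M * (\<integral>x. \<bar>b x\<bar> \<partial>unit_leb))"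
    using a b by simp
  also have "\<dots> \<le> C * (M * c + M * c)"
    using a b M C by (intro mult_left_mono add_mono) simp_all
  \<comment> \<open>Enlarging 2 M to 4 M completes the p-th power of 4 M, at the price of a factor
    2^(1/p) in the norm.\<close>
  also have "\<dots> \<le> C * (4 * M * c)"
    using M C c by (intro mult_left_mono) simp_all
  also have "\<dots> = (4 * M) powr p * c" using C(2) by (metis mult.assoc)
  also have "\<dots> = (4 * M * c powr (1 / p)) powr p"
    using c p by (simp add: powr_mult powr_powr)
  finally show "Lp_norm (ereal p) r \<le> 4 * M * cut_norm (\<lambda>x y. U x y - W x y) powr (1 / p)"
    using M by (subst Lp_norm_le_iff[OF p]) (simp_all add: c_def V_def[abs_def])
qed

lemma diffusion_op_diff:
  assumes K[measurable]: "case_prod K \<in> borel_measurable (unit_leb \<Otimes>\<^sub>M unit_leb)"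
    and b: "\<And>x y. \<bar>K x y\<bar> \<le> B"
    and f: "integrable unit_leb f" and g: "integrable unit_leb g" and x: "x \<in> unit_ivl"
  shows "diffusion_op K (\<lambda>x. f x - g x) x = diffusion_op K f x - diffusion_op K g x"
proof -
  have [measurable]: "K x \<in> borel_measurable unit_leb" using x by simp
  have int: "integrable unit_leb (\<lambda>y. K x y * (k y - k x))" if k: "integrable unit_leb k" for k
  proof (rule Bochner_Integration.integrable_bound)
    have [measurable]: "k \<in> borel_measurable unit_leb" using k by auto
    show "(\<lambda>y. K x y * (k y - k x)) \<in> borel_measurable unit_leb" by measurable
    show "integrable unit_leb (\<lambda>y. \<bar>B\<bar> * (k y - k x))" using k by simp
    show "AE y in unit_leb. norm (K x y * (k y - k x)) \<le> norm (\<bar>B\<bar> * (k y - k x))"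
      using order_trans[OF b[of x] abs_ge_self] by (simp add: abs_mult mult_right_mono)
  qed
  have "diffusion_op K f x - diffusion_op K g x = (\<integral>y. K x y * (f y - f x) - K x y * (g y - g x) \<partial>unit_leb)"
    unfolding diffusion_op_def using int[OF f] int[OF g] by simp
  also have "\<dots> = diffusion_op K (\<lambda>x. f x - g x) x"
    unfolding diffusion_op_def by (simp add: algebra_simps)
  finally show ?thesis by simp
qed

text \<open>K stands for the step graphon. The bound B only secures integrability and does not enter
  the estimate, so it may depend on n.\<close>

lemma diffusion_error_estimate:
  assumes p: "1 \<le> p" and K: "graphon K" and W: "graphon W"
    and K_meas: "case_prod K \<in> borel_measurable (unit_leb \<Otimes>\<^sub>M unit_leb)"
    and b: "\<And>x y. \<bar>K x y\<bar> \<le> B"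
    and w: "diffusion_solution (ereal p) T K w" and u: "diffusion_solution \<infinity> T W u"
    and t: "t \<in> {0..T}"
  shows "Lp_norm (ereal p) (\<lambda>x. u t x - w t x) \<le> Lp_norm (ereal p) (\<lambda>x. u 0 x - w 0 x)
    + 4 * t * Lp_norm \<infinity> (u 0) * cut_norm (\<lambda>x y. K x y - W x y) powr (1 / p)"
proof -
  let ?q = "ereal p" and ?c = "cut_norm (\<lambda>x y. K x y - W x y) powr (1 / p)"
  have q: "1 \<le> ?q" using p by simp
  obtain u' where u_inf: "C1_Lp \<infinity> T u u'"
    and u_eq: "\<And>t. t \<in> {0..T} \<Longrightarrow> AE x in unit_leb. u' t x = diffusion_op W (u t) x"
    using u unfolding diffusion_solution_def by blast
  obtain w' where w_C1: "C1_Lp ?q T w w'"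
    and w_eq: "\<And>t. t \<in> {0..T} \<Longrightarrow> AE x in unit_leb. w' t x = diffusion_op K (w t) x"
    using w unfolding diffusion_solution_def by blast
  note u_C1 = C1_Lp_inf_imp[OF p u_inf]
  have S: "u s \<in> Lp_space ?q" "u' s \<in> Lp_space ?q" "w s \<in> Lp_space ?q" "w' s \<in> Lp_space ?q"
    if "s \<in> {0..T}" for s
    using u_C1 w_C1 that by (auto simp: C1_Lp_def)
  have u_bound: "AE x in unit_leb. \<bar>u s x\<bar> \<le> Lp_norm \<infinity> (u 0)" if "s \<in> {0..T}" for s
    using Linf_solution_bound[OF W u_inf u_eq that] .
  have u0: "0 \<le> Lp_norm \<infinity> (u 0)"
    using u_inf t by (intro Lp_norm_nonneg) (auto simp: C1_Lp_def)
  \<comment> \<open>M lies strictly above the initial sup norm, so it is positive even for u(0) =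
    0.\<close>
  have estimate: "Lp_norm ?q (\<lambda>x. u t x - w t x) \<le> Lp_norm ?q (\<lambda>x. u 0 x - w 0 x) + (4 * M * ?c) * t"
    if M: "Lp_norm \<infinity> (u 0) < M" for M
  proof (rule Lp_norm_growth[OF q C1_Lp_diff[OF q u_C1 w_C1] _ t])
    fix s h :: real assume s: "s \<in> {0..T}" and h: "0 < h" "h \<le> 1"
    define v where "v x = u s x - w s x" for x
    \<comment> \<open>Written with u' in place of \<open>diffusion_op W (u s)\<close>: the two agree
      almost everywhere, and u' is measurable by assumption.\<close>
    define r where "r x = u' s x - diffusion_op K (u s) x" for x
    define A where "A x = v x + h * diffusion_op K v x" for x
    have vS: "v \<in> Lp_space ?q" unfolding v_def using s by (intro Lp_space_diff q S)
    note [measurable] = S(1,2,3,4)[OF s, THEN Lp_space_measurable] vS[THEN Lp_space_measurable]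
    have op[measurable]: "diffusion_op K (u s) \<in> borel_measurable unit_leb"
      "diffusion_op K v \<in> borel_measurable unit_leb"
      by (intro diffusion_op_measurable[OF K_meas]; measurable)+
    have r_meas[measurable]: "r \<in> borel_measurable unit_leb" unfolding r_def by measurable
    have [measurable]: "A \<in> borel_measurable unit_leb" unfolding A_def by measurable
    have r_eq: "AE x in unit_leb. r x = diffusion_op W (u s) x - diffusion_op K (u s) x"
      using u_eq[OF s] by eventually_elim (simp add: r_def)
    have uM: "AE x in unit_leb. \<bar>u s x\<bar> \<le> M"
      using u_bound[OF s] by eventually_elim (use M in simp)
    have M0: "0 < M" using u0 M by simp
    note r = consistency_error_bound[OF p K W M0 _ uM r_meas r_eq, OF Lp_space_measurable[OF S(1)[OF s]]]
    have A: "A \<in> Lp_space ?q" "Lp_norm ?q A \<le> Lp_norm ?q v"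
      unfolding A_def using h
      by (intro Lp_euler_step_contraction[OF p _ _ K_meas b graphonD(3)[OF K] graphonD(2)[OF K] graphonD(4)[OF K] vS];
        simp)+
    \<comment> \<open>The Euler step of the difference is the contractive step A for K plus h times
      the consistency error.\<close>
    have "AE x in unit_leb. v x + h * (u' s x - w' s x) = A x + h * r x"
      using w_eq[OF s] AE_space
    proof eventually_elim
      case (elim x)
      then have op_v: "diffusion_op K v x = diffusion_op K (u s) x - diffusion_op K (w s) x"
        unfolding v_def using s
        by (intro diffusion_op_diff[OF K_meas b] Lp_space_imp_integrable[OF p] S) simp_all
      then show ?case using elim(1) by (simp add: A_def r_def op_v algebra_simps)
    qed
    then have "Lp_norm ?q (\<lambda>x. v x + h * (u' s x - w' s x)) = Lp_norm ?q (\<lambda>x. A x + h * r x)"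
      by (rule Lp_norm_cong_AE[rotated 2]) measurable
    also have "\<dots> \<le> Lp_norm ?q A + Lp_norm ?q (\<lambda>x. h * r x)"
      by (intro Lp_norm_triangle Lp_space_cmult q A r)
    also have "\<dots> \<le> Lp_norm ?q v + \<bar>h\<bar> * Lp_norm ?q r"
      by (intro add_mono A Lp_norm_cmult_le q r)
    also have "\<dots> \<le> Lp_norm ?q v + h * (4 * M * ?c)"
      using h r(2) by (simp add: mult_left_mono)
    finally show "Lp_norm ?q (\<lambda>x. u s x - w s x + h * (u' s x - w' s x))
        \<le> Lp_norm ?q (\<lambda>x. u s x - w s x) + h * (4 * M * ?c)"
      by (simp add: v_def[abs_def])
  qed
  \<comment> \<open>The right side is continuous in M, so M may decrease to the initial sup
    norm.\<close>
  have "((\<lambda>M. Lp_norm ?q (\<lambda>x. u 0 x - w 0 x) + (4 * M * ?c) * t) \<longlongrightarrow>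
      Lp_norm ?q (\<lambda>x. u 0 x - w 0 x) + (4 * Lp_norm \<infinity> (u 0) * ?c) * t) (at_right (Lp_norm \<infinity> (u 0)))"
    by (intro tendsto_intros)
  then have "Lp_norm ?q (\<lambda>x. u t x - w t x)
      \<le> Lp_norm ?q (\<lambda>x. u 0 x - w 0 x) + (4 * Lp_norm \<infinity> (u 0) * ?c) * t"
    by (rule tendsto_lowerbound) (auto simp: eventually_at_filter intro!: always_eventually estimate)
  then show ?thesis by (simp add: mult_ac)
qed

theorem theorem3p3:
  fixes p T :: real
    and A :: "nat \<Rightarrow> nat \<Rightarrow> nat \<Rightarrow> real"
    and Wn :: "nat \<Rightarrow> real \<Rightarrow> real \<Rightarrow> real"
    and W :: "real \<Rightarrow> real \<Rightarrow> real"
    and un :: "nat \<Rightarrow> real \<Rightarrow> real \<Rightarrow> real"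
    and u :: "real \<Rightarrow> real \<Rightarrow> real"
  assumes "1 \<le> p" and "0 < T"
    and "\<And>n. 1 \<le> n \<Longrightarrow> weighted_simple_graph n (A n)"
    and "\<And>n. 1 \<le> n \<Longrightarrow> Wn n = step_graphon n (A n)"
    and "\<And>n. 1 \<le> n \<Longrightarrow> graphon (Wn n)"
    and "graphon W"
    and "(\<lambda>n. cut_norm (\<lambda>x y. Wn n x y - W x y)) \<longlonglongrightarrow> 0"
    and "\<And>n. 1 \<le> n \<Longrightarrow> diffusion_solution (ereal p) T (Wn n) (un n)"
    and "diffusion_solution \<infinity> T W u"
  shows "\<forall>n\<ge>1. \<forall>t\<in>{0..T}.
    Lp_norm (ereal p) (\<lambda>x. u t x - un n t x)
      \<le> Lp_norm (ereal p) (\<lambda>x. u 0 x - un n 0 x)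
        + 4 * t * Lp_norm \<infinity> (u 0) * cut_norm (\<lambda>x y. Wn n x y - W x y) powr (1 / p)"
proof (intro allI impI ballI)
  fix n :: nat and t assume n: "1 \<le> n" and t: "t \<in> {0..T}"
  show "Lp_norm (ereal p) (\<lambda>x. u t x - un n t x)
      \<le> Lp_norm (ereal p) (\<lambda>x. u 0 x - un n 0 x)
        + 4 * t * Lp_norm \<infinity> (u 0) * cut_norm (\<lambda>x y. Wn n x y - W x y) powr (1 / p)"
  proof (rule diffusion_error_estimate[OF assms(1) assms(5)[OF n] assms(6) _ _ assms(8)[OF n] assms(9) t])
    show "case_prod (Wn n) \<in> borel_measurable (unit_leb \<Otimes>\<^sub>M unit_leb)"
      unfolding assms(4)[OF n] by (rule step_graphon_measurable)
    show "\<bar>Wn n x y\<bar> \<le> (\<Sum>i=1..n. \<Sum>j=1..n. \<bar>A n i j\<bar>)" for x y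
      unfolding assms(4)[OF n] by (rule step_graphon_bounded)
  qed
qed

end
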